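(* Let $\lambda>0$ and let $u_0\in \mathrm{BPC}^2(\mathbb{R})$ with $u_0\ge 0$. Then the equation $$\partial_t u=\partial_{xx}u+\lambda\,u\ln(u^2),\qquad t>0,\ x\in\mathbb{R},$$ has a unique (global) solution $u:[0,\infty)\times\mathbb{R}\to\mathbb{R}$ starting from $u_0$.
   Context: $\mathrm{BPC}^2(\mathbb{R})$ denotes the set of functions $u_0:\mathbb{R}\to\mathbb{R}$ that are continuous and bounded, with continuous and bounded derivative, and bounded and piecewise continuous second derivative. The nonlinearity $z\mapsto \lambda z\ln(z^2)$ is extended by the value $0$ at $z=0$. Notion of solution: for $u_0\in\mathrm{BPC}^2(\mathbb{R})$, a (global) solution starting from $u_0$ is a function $u:[0,\infty)\times\mathbb{R}\to\mathbb{R}$ such that, for every $T>0$: $u$ is continuous and bounded on $[0,T]\times\mathbb{R}$; $u_t,u_x,u_{xx}$ exist and are continuous on $(0,T]\times\mathbb{R}$; $u$ satisfies the equation on $(0,T]\times\mathbb{R}$; $u(t,x)$ is uniformly bounded as $|x|\to\infty$ for $t\in[0,T]$; and $u(0,\cdot)=u_0$. *)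

theory Defs
  imports "HOL-Analysis.Analysis"
begin

text \<open>
  \<open>f\<close> is piecewise continuous on the real line with breakpoints in \<open>S\<close>: only finitely many
  breakpoints in each bounded interval, continuity elsewhere, and finite one-sided limits at every
  breakpoint. The values of \<open>f\<close> on \<open>S\<close> are irrelevant, so \<open>f\<close> may be undefined there.
\<close>
definition piecewise_continuous_off :: "real set \<Rightarrow> (real \<Rightarrow> real) \<Rightarrow> bool" where
  "piecewise_continuous_off S f \<longleftrightarrow>
     (\<forall>a b. finite (S \<inter> {a..b})) \<and>
     continuous_on (- S) f \<and>
     (\<forall>x\<in>S. (\<exists>l. (f \<longlongrightarrow> l) (at_left x)) \<and> (\<exists>r. (f \<longlongrightarrow> r) (at_right x)))"

text \<open>The second derivative need not exist at its breakpoints \<open>S\<close>.\<close>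
definition BPC2 :: "(real \<Rightarrow> real) set" where
  "BPC2 = {f. continuous_on UNIV f \<and> bounded (range f) \<and>
     (\<exists>f' f'' S.
        (\<forall>x. (f has_real_derivative f' x) (at x)) \<and>
        continuous_on UNIV f' \<and> bounded (range f') \<and>
        (\<forall>x\<in>- S. (f' has_real_derivative f'' x) (at x)) \<and>
        bounded (f'' ` (- S)) \<and> piecewise_continuous_off S f'')}"

definition log_nonlinearity :: "real \<Rightarrow> real \<Rightarrow> real" where
  "log_nonlinearity lam z = (if z = 0 then 0 else lam * z * ln (z\<^sup>2))"

text \<open>
  The argument order is \<open>u t x\<close>; values of \<open>u\<close> outside \<open>[0,T] \<times> \<real>\<close> play no role. The time
  derivative is taken relative to \<open>(0,T]\<close>, hence two-sided for \<open>t < T\<close> and from the left at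
  \<open>t = T\<close>.
\<close>
definition solution_upto ::
  "real \<Rightarrow> (real \<Rightarrow> real) \<Rightarrow> real \<Rightarrow> (real \<Rightarrow> real \<Rightarrow> real) \<Rightarrow> bool" where
  "solution_upto lam u0 T u \<longleftrightarrow>
     continuous_on ({0..T} \<times> UNIV) (\<lambda>(t, x). u t x) \<and>
     bounded ((\<lambda>(t, x). u t x) ` ({0..T} \<times> UNIV)) \<and>
     (\<exists>ut ux uxx.
        (\<forall>t\<in>{0<..T}. \<forall>x.
           ((\<lambda>s. u s x) has_real_derivative ut t x) (at t within {0<..T}) \<and>
           ((\<lambda>y. u t y) has_real_derivative ux t x) (at x) \<and>
           ((\<lambda>y. ux t y) has_real_derivative uxx t x) (at x)) \<and>
        continuous_on ({0<..T} \<times> UNIV) (\<lambda>(t, x). ut t x) \<and>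
        continuous_on ({0<..T} \<times> UNIV) (\<lambda>(t, x). ux t x) \<and>
        continuous_on ({0<..T} \<times> UNIV) (\<lambda>(t, x). uxx t x) \<and>
        (\<forall>t\<in>{0<..T}. \<forall>x. ut t x = uxx t x + log_nonlinearity lam (u t x))) \<and>
     (\<exists>M R. \<forall>t\<in>{0..T}. \<forall>x. \<bar>x\<bar> \<ge> R \<longrightarrow> \<bar>u t x\<bar> \<le> M) \<and>
     (\<forall>x. u 0 x = u0 x)"

text \<open>For \<open>T\<close> ranging over all positive reals, all time derivatives at \<open>t > 0\<close> are two-sided.\<close>
definition global_solution :: "real \<Rightarrow> (real \<Rightarrow> real) \<Rightarrow> (real \<Rightarrow> real \<Rightarrow> real) \<Rightarrow> bool" where
  "global_solution lam u0 u \<longleftrightarrow> (\<forall>T>0. solution_upto lam u0 T u)"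

end

theory Submission
  imports Defs "HOL-Probability.Distributions"
begin

text \<open>
  The map \<open>z \<mapsto> z * ln \<bar>z\<bar>\<close> has derivative bounded above on bounded sets, although it is not Lipschitz
  at \<open>0\<close>. This one-sided bound gives uniqueness by the maximum principle, without a sign
  condition on the solutions.

  For existence, \<open>u = exp (A * exp (2 * lam * t)) * w\<close> with \<open>A\<close> large turns the problem into the same
  equation for \<open>w\<close> with initial values in \<open>[0, 1/e]\<close>. On this interval \<open>- z * ln z\<close> is nonnegative,
  nondecreasing and Hoelder continuous of order 1/2. Truncating the nonlinearity near \<open>0\<close> makes it Lipschitz, and
  Picard iteration solves Duhamel's formula. Duhamel integrals of sources that are Hoelder
  continuous in space are classical solutions, so the maximum principle applies; by monotonicity, the
  distance at time \<open>t\<close> between two truncated solutions is at most \<open>t\<close> times the distance of their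
  nonlinearities. Hence the truncated solutions converge locally uniformly in time, and the limit solves Duhamel's
  formula for the original nonlinearity, hence is classical. The maximum principle also keeps
  it in \<open>[0, 1/e]\<close>.
\<close>

section \<open>Maximum principle and uniqueness\<close>

text \<open>The factor \<open>exp (A * exp (2 * lam * t))\<close> is the spatially constant solution
  with value \<open>exp A\<close> at time 0; since ln turns products into sums, dividing by it
  preserves the form of the equation. On [0, 1/e] the reaction only absorbs, and absorbs more where
  \<open>w\<close> is larger. This is essential: the Lipschitz constant of the truncated term grows
  like -ln \<epsilon> as \<epsilon> tends to 0, so the constants of a Gronwall estimate blow up,
  whereas the comparison argument never uses that constant. The exponent 1/2 matters because the
  second space derivative of the heat kernel has L1 norm of order 1/r; acting on increments of order
  sqrt |x - y| it improves to r^(-3/4), which is integrable. Mild solutions are Lipschitz in space,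
  because the initial derivative is bounded and r^(-1/2) is integrable, so their reaction terms are
  Hoelder of order 1/2. In time the source is merely continuous; hence the time derivative of a
  Duhamel integral is obtained by exchanging integrals, not by differentiating under the
  integral.\<close>

lemma second_derivative_nonpos_at_max:
  fixes h :: "real \<Rightarrow> real"
  assumes d1: "\<And>x. (h has_real_derivative h' x) (at x)"
    and d2: "(h' has_real_derivative c) (at a)"
    and max: "\<And>x. h x \<le> h a"
  shows "c \<le> 0"
proof (rule ccontr)
  assume "\<not> c \<le> 0"
  then have "c > 0" by simp
  have h0: "h' a = 0"
    using DERIV_local_max[OF d1, of 1 a] max by auto
  obtain d where d: "d > 0" "\<And>e. 0 < e \<Longrightarrow> e < d \<Longrightarrow> h' a < h' (a + e)"
    using DERIV_pos_inc_right[OF d2 \<open>c > 0\<close>] by auto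
  \<comment> \<open>If \<open>c\<close> were positive, \<open>h'\<close> would vanish at
    \<open>a\<close> and be positive just to the right, so \<open>h\<close> would exceed its maximum
    there.\<close>
  obtain \<xi> where \<xi>: "a < \<xi>" "\<xi> < a + d/2" "h (a + d/2) - h a = (a + d/2 - a) * h' \<xi>"
    using MVT2[of a "a + d/2" h h'] d(1) d1 by auto
  have "h' \<xi> > 0"
    using d(2)[of "\<xi> - a"] \<xi> d(1) h0 by auto
  then have "h (a + d/2) > h a"
    using \<xi>(3) d(1) by (smt (verit) mult_pos_pos half_gt_zero)
  with max[of "a + d/2"] show False by simp
qed

text \<open>The barrier \<open>\<epsilon> (1 + 3 t + x\<^sup>2)\<close> is a strict supersolution of the heat equation and forces
  the maximum of \<open>z - barrier\<close> to be attained.\<close>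

lemma maximum_principle:
  fixes z :: "real \<Rightarrow> real \<Rightarrow> real"
  assumes cont: "continuous_on ({0..T} \<times> UNIV) (\<lambda>(t, x). z t x)"
    and bound: "\<And>t x. t \<in> {0..T} \<Longrightarrow> z t x \<le> B"
    and init: "\<And>x. z 0 x \<le> 0"
    and dt: "\<And>t x. t \<in> {0<..T} \<Longrightarrow> ((\<lambda>s. z s x) has_real_derivative zt t x) (at t within {0<..T})"
    and dx: "\<And>t x. t \<in> {0<..T} \<Longrightarrow> ((\<lambda>y. z t y) has_real_derivative zx t x) (at x)"
    and dxx: "\<And>t x. t \<in> {0<..T} \<Longrightarrow> ((\<lambda>y. zx t y) has_real_derivative zxx t x) (at x)"
    and ineq: "\<And>t x. t \<in> {0<..T} \<Longrightarrow> z t x > 0 \<Longrightarrow> zt t x \<le> zxx t x"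
    and t: "t \<in> {0..T}"
  shows "z t x \<le> 0"
proof -
  have key: "z t1 x1 \<le> e * (1 + 3 * t1 + x1\<^sup>2)" if e: "e > 0" and t1: "t1 \<in> {0..T}" for e t1 x1
  proof (rule ccontr)
    define Z where "Z = (\<lambda>t x. z t x - e * (1 + 3 * t + x\<^sup>2))"
    assume "\<not> ?thesis"
    then have pos: "Z t1 x1 > 0" by (simp add: Z_def)
    \<comment> \<open>Beyond \<open>sqrt (\<bar>B\<bar> / e)\<close> the quadratic part of the
      barrier already outweighs \<open>B\<close>; including \<open>\<bar>x1\<bar>\<close> keeps the
      point where \<open>Z\<close> is positive inside the compact box.\<close>
    define R where "R = max \<bar>x1\<bar> (sqrt (\<bar>B\<bar> / e))"
    have outside: "Z t x < 0" if "t \<in> {0..T}" "\<bar>x\<bar> \<ge> R" for t x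
    proof -
      have "sqrt (\<bar>B\<bar> / e) \<le> \<bar>x\<bar>" using that R_def by auto
      then have "\<bar>B\<bar> / e \<le> x\<^sup>2"
        by (metis abs_ge_zero power2_abs real_le_lsqrt real_sqrt_le_iff real_sqrt_abs order_trans)
      then have "\<bar>B\<bar> \<le> e * x\<^sup>2" using e by (simp add: field_simps)
      moreover have "e * (1 + 3 * t + x\<^sup>2) = e + 3 * (e * t) + e * x\<^sup>2" by (simp add: algebra_simps)
      moreover have "e * t \<ge> 0" using that e by auto
      ultimately show ?thesis
        using bound[OF that(1), of x] e unfolding Z_def by linarith
    qed
    have "continuous_on ({0..T} \<times> {-R..R}) (\<lambda>(t, x). z t x)"
      using cont by (rule continuous_on_subset) auto
    then have "continuous_on ({0..T} \<times> {-R..R}) (\<lambda>p. Z (fst p) (snd p))"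
      unfolding Z_def case_prod_beta by (intro continuous_intros) auto
    moreover have "compact ({0..T} \<times> {-R..R})" by (intro compact_Times) auto
    moreover have "(t1, x1) \<in> {0..T} \<times> {-R..R}" using t1 R_def by auto
    ultimately obtain p where p: "p \<in> {0..T} \<times> {-R..R}"
      "\<forall>q\<in>{0..T} \<times> {-R..R}. Z (fst q) (snd q) \<le> Z (fst p) (snd p)"
      using continuous_attains_sup by (metis (no_types, lifting) empty_iff)
    obtain t0 x0 where p0: "p = (t0, x0)" by fastforce
    have t0: "t0 \<in> {0..T}" using p p0 by auto
    have Zpos: "Z t0 x0 > 0" using bspec[OF p(2) \<open>(t1, x1) \<in> _\<close>] p0 pos by simp
    have Zmax: "Z t x \<le> Z t0 x0" if "t \<in> {0..T}" for t x
    proof (cases "\<bar>x\<bar> \<ge> R")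
      case True
      then show ?thesis using outside[OF that True] Zpos by simp
    next
      case False
      then have "(t, x) \<in> {0..T} \<times> {-R..R}" using that by auto
      then show ?thesis using bspec[OF p(2)] p0 by fastforce
    qed
    have "t0 \<noteq> 0"
    proof
      assume "t0 = 0"
      moreover have "0 \<le> e * (1 + x0\<^sup>2)" using e by simp
      ultimately show False using Zpos init[of x0] by (simp add: Z_def)
    qed
    then have t0': "t0 \<in> {0<..T}" using t0 by auto
    have "zxx t0 x0 - 2 * e \<le> 0"
    proof (rule second_derivative_nonpos_at_max)
      show "((\<lambda>x. Z t0 x) has_real_derivative (zx t0 x - e * (2 * x))) (at x)" for x
        unfolding Z_def by (rule derivative_eq_intros dx[OF t0'] refl | simp)+
      show "((\<lambda>x. zx t0 x - e * (2 * x)) has_real_derivative (zxx t0 x0 - 2 * e)) (at x0)"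
        by (rule derivative_eq_intros dxx[OF t0'] refl | simp)+
      show "Z t0 x \<le> Z t0 x0" for x using Zmax[OF t0] .
    qed
    \<comment> \<open>The maximum may sit at \<open>t0 = T\<close>, so only earlier times are
      compared: a negative time derivative would make \<open>Z\<close> larger slightly before
      \<open>t0\<close>.\<close>
    moreover have "zt t0 x0 - 3 * e \<ge> 0"
    proof (rule ccontr)
      assume "\<not> ?thesis"
      then have neg: "zt t0 x0 - 3 * e < 0" by simp
      have "((\<lambda>t. Z t x0) has_real_derivative (zt t0 x0 - 3 * e)) (at t0 within {0<..T})"
        unfolding Z_def by (rule derivative_eq_intros dt[OF t0'] refl | simp)+
      from has_real_derivative_neg_dec_left[OF this neg] obtain d where
        d: "d > 0" "\<And>h. h > 0 \<Longrightarrow> t0 - h \<in> {0<..T} \<Longrightarrow> h < d \<Longrightarrow> Z t0 x0 < Z (t0 - h) x0"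
        by blast
      define h where "h = min (d/2) (t0/2)"
      have "h > 0" "h < d" "t0 - h \<in> {0<..T}" using d(1) t0' by (auto simp: h_def)
      then have "Z t0 x0 < Z (t0 - h) x0" using d(2) by blast
      with Zmax[of "t0 - h" x0] \<open>t0 - h \<in> {0<..T}\<close> show False by auto
    qed
    \<comment> \<open>The differential inequality is available only where \<open>z\<close> is
      positive, which is exactly where one-sided and monotonicity arguments supply it.\<close>
    moreover have "z t0 x0 > 0"
    proof -
      have "e * (1 + 3 * t0 + x0\<^sup>2) \<ge> 0" using e t0 by auto
      then show ?thesis using Zpos by (simp add: Z_def)
    qed
    \<comment> \<open>Now \<open>zt\<close> is at least \<open>3 * e\<close> and \<open>zxx\<close>
      at most \<open>2 * e\<close>; the coefficient 3 of time in the barrier was chosen to beat the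
      2 produced by the square.\<close>
    ultimately show False using ineq[OF t0'] e by fastforce
  qed
  show ?thesis
  proof (rule field_le_epsilon)
    fix e :: real assume "e > 0"
    have pos: "1 + 3 * t + x\<^sup>2 > 0" using t by (auto intro: add_pos_nonneg)
    have "z t x \<le> e / (1 + 3 * t + x\<^sup>2) * (1 + 3 * t + x\<^sup>2)"
      using key[of "e / (1 + 3 * t + x\<^sup>2)" t x] t pos \<open>e > 0\<close> by simp
    also have "\<dots> = e" using pos by simp
    finally show "z t x \<le> 0 + e" by simp
  qed
qed

section \<open>One-sided Lipschitz bound for the logarithmic nonlinearity, and uniqueness\<close>

lemma log_nonlinearity_minus: "log_nonlinearity lam (- z) = - log_nonlinearity lam z"
  by (simp add: log_nonlinearity_def)

lemma log_nonlinearity_pos: "z > 0 \<Longrightarrow> log_nonlinearity lam z = 2 * lam * (z * ln z)"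
  by (simp add: log_nonlinearity_def ln_realpow)

text \<open>Convexity: the graph of z ln z lies above its tangent at \<open>b\<close>, whose slope
  is \<open>ln b + 1\<close>.\<close>

lemma mult_ln_diff_le:
  fixes a b :: real
  assumes "0 < a" "a \<le> b"
  shows "b * ln b - a * ln a \<le> (b - a) * (ln b + 1)"
proof -
  have "a * (ln b - ln a) \<le> a * (b / a - 1)"
    using assms ln_le_minus_one[of "b / a"] by (intro mult_left_mono) (auto simp: ln_div)
  then show ?thesis using assms by (simp add: algebra_simps)
qed

text \<open>The slope \<open>ln z + 1\<close> of z ln z is at most \<open>B\<close> on (0, B]; that
  it tends to minus infinity at 0 does no harm to an upper bound. Negative arguments follow by
  oddness, and arguments of opposite sign by splitting the interval at 0.\<close>

lemma log_nonlinearity_one_sided_lipschitz: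
  assumes lam: "lam > 0" and "v < u" and "\<bar>u\<bar> \<le> B" and "\<bar>v\<bar> \<le> B"
  shows "log_nonlinearity lam u - log_nonlinearity lam v \<le> 2 * lam * B * (u - v)"
proof -
  have ln_le: "ln x \<le> B - 1" if "0 < x" "x \<le> B" for x :: real
    using ln_le_minus_one[OF that(1)] that by linarith
  have pos: "log_nonlinearity lam b - log_nonlinearity lam a \<le> 2 * lam * B * (b - a)"
    if "0 \<le> a" "a < b" "b \<le> B" for a b
  proof -
    have "b * ln b - a * ln a \<le> (b - a) * B"
    proof (cases "a = 0")
      case True
      have "b * ln b \<le> b * B" using that ln_le[of b] by (intro mult_left_mono) auto
      then show ?thesis using True by simp
    next
      case False
      have "(b - a) * (ln b + 1) \<le> (b - a) * B" using that ln_le[of b] by (intro mult_left_mono) auto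
      then show ?thesis using mult_ln_diff_le[of a b] False that by linarith
    qed
    then have "2 * lam * (b * ln b - a * ln a) \<le> 2 * lam * ((b - a) * B)"
      using lam by (intro mult_left_mono) auto
    moreover have "log_nonlinearity lam a = 2 * lam * (a * ln a)"
      using that log_nonlinearity_pos[of a] by (cases "a = 0") (auto simp: log_nonlinearity_def)
    ultimately show ?thesis using that log_nonlinearity_pos[of b] by (simp add: algebra_simps)
  qed
  consider "0 \<le> v" | "u \<le> 0" | "v < 0" "0 < u" by linarith
  then show ?thesis
  proof cases
    case 1
    then show ?thesis using pos[of v u] assms by auto
  next
    case 2
    then show ?thesis using pos[of "- u" "- v"] assms by (auto simp: log_nonlinearity_minus)
  next
    case 3
    then show ?thesis using pos[of 0 u] pos[of 0 "- v"] assms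
      by (auto simp: log_nonlinearity_minus algebra_simps log_nonlinearity_def[of _ 0])
  qed
qed

text \<open>Where u exceeds v, the one-sided bound gives (u - v)_t \<le> (u - v)_xx + L (u - v). The
  weight \<open>exp (- L * t)\<close> removes the last term, which leaves the situation of the
  maximum principle. Exchanging the two solutions turns the inequality into uniqueness.\<close>

lemma solution_upto_le:
  assumes lam: "lam > 0" and u: "solution_upto lam u0 T u" and v: "solution_upto lam u0 T v"
    and t: "t \<in> {0..T}"
  shows "u t x \<le> v t x"
proof -
  from u obtain ut ux uxx where u': "continuous_on ({0..T} \<times> UNIV) (\<lambda>(t, x). u t x)"
     "bounded ((\<lambda>(t, x). u t x) ` ({0..T} \<times> UNIV))"
     "\<And>t x. t\<in>{0<..T} \<Longrightarrow> ((\<lambda>s. u s x) has_real_derivative ut t x) (at t within {0<..T})"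
     "\<And>t x. t\<in>{0<..T} \<Longrightarrow> ((\<lambda>y. u t y) has_real_derivative ux t x) (at x)"
     "\<And>t x. t\<in>{0<..T} \<Longrightarrow> ((\<lambda>y. ux t y) has_real_derivative uxx t x) (at x)"
     "\<And>t x. t\<in>{0<..T} \<Longrightarrow> ut t x = uxx t x + log_nonlinearity lam (u t x)"
     "\<And>x. u 0 x = u0 x"
    unfolding solution_upto_def by metis
  from v obtain vt vx vxx where v': "continuous_on ({0..T} \<times> UNIV) (\<lambda>(t, x). v t x)"
     "bounded ((\<lambda>(t, x). v t x) ` ({0..T} \<times> UNIV))"
     "\<And>t x. t\<in>{0<..T} \<Longrightarrow> ((\<lambda>s. v s x) has_real_derivative vt t x) (at t within {0<..T})"
     "\<And>t x. t\<in>{0<..T} \<Longrightarrow> ((\<lambda>y. v t y) has_real_derivative vx t x) (at x)"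
     "\<And>t x. t\<in>{0<..T} \<Longrightarrow> ((\<lambda>y. vx t y) has_real_derivative vxx t x) (at x)"
     "\<And>t x. t\<in>{0<..T} \<Longrightarrow> vt t x = vxx t x + log_nonlinearity lam (v t x)"
     "\<And>x. v 0 x = u0 x"
    unfolding solution_upto_def by metis
  obtain Bu where Bu: "\<And>t x. t \<in> {0..T} \<Longrightarrow> \<bar>u t x\<bar> \<le> Bu"
    using u'(2) unfolding bounded_iff by (metis (no_types, lifting) UNIV_I SigmaI case_prod_conv image_eqI real_norm_def)
  obtain Bv where Bv: "\<And>t x. t \<in> {0..T} \<Longrightarrow> \<bar>v t x\<bar> \<le> Bv"
    using v'(2) unfolding bounded_iff by (metis (no_types, lifting) UNIV_I SigmaI case_prod_conv image_eqI real_norm_def)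
  define B where "B = max Bu Bv"
  have B: "\<bar>u t x\<bar> \<le> B" "\<bar>v t x\<bar> \<le> B" if "t \<in> {0..T}" for t x
    using Bu[OF that, of x] Bv[OF that, of x] by (auto simp: B_def)
  have B0: "B \<ge> 0" using B(1)[OF t, of x] by linarith
  define L where "L = 2 * lam * B"
  have L0: "L \<ge> 0" using lam B0 by (simp add: L_def)
  define E where "E = (\<lambda>t. exp (- L * t))"
  have E: "E t > 0" "(E has_real_derivative - L * E t) (at t within S)" for t S
    unfolding E_def by (auto intro!: derivative_eq_intros)
  have "E t * (u t x - v t x) \<le> 0"
  proof (rule maximum_principle[where B = "2 * B" and T = T and z = "\<lambda>t x. E t * (u t x - v t x)"
        and zt = "\<lambda>t x. - L * E t * (u t x - v t x) + E t * (ut t x - vt t x)"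
        and zx = "\<lambda>t x. E t * (ux t x - vx t x)" and zxx = "\<lambda>t x. E t * (uxx t x - vxx t x)"])
    show "continuous_on ({0..T} \<times> UNIV) (\<lambda>(t, x). E t * (u t x - v t x))"
      using u'(1) v'(1) unfolding E_def case_prod_beta by (intro continuous_intros) auto
    show "E t * (u t x - v t x) \<le> 2 * B" if "t \<in> {0..T}" for t x
    proof -
      have "E t * (u t x - v t x) \<le> E t * (2 * B)"
        using B[OF that, of x] E(1)[of t] by (intro mult_left_mono) (auto simp: abs_le_iff)
      also have "\<dots> \<le> 1 * (2 * B)"
        using that L0 B0 by (intro mult_right_mono) (auto simp: E_def)
      finally show ?thesis by simp
    qed
    show "E 0 * (u 0 x - v 0 x) \<le> 0" for x using u'(7) v'(7) by simp
    fix t x assume t: "t \<in> {0<..T}"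
    then have t': "t \<in> {0..T}" by auto
    show "((\<lambda>s. E s * (u s x - v s x)) has_real_derivative
        - L * E t * (u t x - v t x) + E t * (ut t x - vt t x)) (at t within {0<..T})"
      by (rule derivative_eq_intros E(2) u'(3)[OF t] v'(3)[OF t] refl)+ (simp add: algebra_simps)
    show "((\<lambda>y. E t * (u t y - v t y)) has_real_derivative E t * (ux t x - vx t x)) (at x)"
      by (rule derivative_eq_intros u'(4)[OF t] v'(4)[OF t] refl | simp)+
    show "((\<lambda>y. E t * (ux t y - vx t y)) has_real_derivative E t * (uxx t x - vxx t x)) (at x)"
      by (rule derivative_eq_intros u'(5)[OF t] v'(5)[OF t] refl | simp)+
    assume "0 < E t * (u t x - v t x)"
    then have "v t x < u t x" using E(1)[of t] by (simp add: zero_less_mult_iff)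
    then have "log_nonlinearity lam (u t x) - log_nonlinearity lam (v t x) \<le> L * (u t x - v t x)"
      unfolding L_def using log_nonlinearity_one_sided_lipschitz[OF lam] B[OF t'] by blast
    then have "ut t x - vt t x - L * (u t x - v t x) \<le> uxx t x - vxx t x"
      using u'(6)[OF t, of x] v'(6)[OF t, of x] by linarith
    then have "E t * (ut t x - vt t x - L * (u t x - v t x)) \<le> E t * (uxx t x - vxx t x)"
      using E(1)[of t] by (intro mult_left_mono) auto
    then show "- L * E t * (u t x - v t x) + E t * (ut t x - vt t x) \<le> E t * (uxx t x - vxx t x)"
      by (simp add: algebra_simps)
  qed (use t in auto)
  then show ?thesis using E(1)[of t] by (simp add: mult_le_0_iff)
qed

section \<open>Gaussian averages and the heat semigroup\<close>

text \<open>The mean value theorem writes each difference quotient as \<open>F'\<close> at an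
  intermediate point, where \<open>w\<close> dominates it; dominated convergence then applies along
  any null sequence of increments. Discarding the first \<open>N\<close> increments keeps the
  intermediate points within distance \<open>e\<close> of \<open>a\<close>.\<close>

lemma has_real_derivative_integral_dominated:
  fixes F :: "real \<Rightarrow> 'a \<Rightarrow> real"
  assumes e: "e > 0"
    and int: "\<And>y. \<bar>y - a\<bar> < e \<Longrightarrow> integrable M (F y)"
    and der: "\<And>y z. \<bar>y - a\<bar> < e \<Longrightarrow> z \<in> space M \<Longrightarrow> ((\<lambda>y. F y z) has_real_derivative F' y z) (at y)"
    and dom: "\<And>y z. \<bar>y - a\<bar> < e \<Longrightarrow> z \<in> space M \<Longrightarrow> \<bar>F' y z\<bar> \<le> w z"
    and w: "integrable M w"
    and meas: "F' a \<in> borel_measurable M"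
  shows "((\<lambda>y. \<integral>z. F y z \<partial>M) has_real_derivative (\<integral>z. F' a z \<partial>M)) (at a)"
  unfolding DERIV_def tendsto_at_iff_sequentially
proof (intro allI impI)
  fix X :: "nat \<Rightarrow> real"
  assume X: "\<forall>i. X i \<in> UNIV - {0}" and lim: "X \<longlonglongrightarrow> 0"
  from lim e have "\<forall>\<^sub>F n in sequentially. \<bar>X n\<bar> < e"
    using tendstoD[OF lim e] by (simp add: dist_real_def)
  then obtain N where N: "\<And>n. n \<ge> N \<Longrightarrow> \<bar>X n\<bar> < e" by (auto simp: eventually_sequentially)
  define s where "s = (\<lambda>n z. (F (a + X (n + N)) z - F a z) / X (n + N))"
  have nz: "X n \<noteq> 0" for n using X by auto
  have "(\<lambda>n. \<integral>z. s n z \<partial>M) \<longlonglongrightarrow> (\<integral>z. F' a z \<partial>M)"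
  proof (rule integral_dominated_convergence[where w = w])
    show "F' a \<in> borel_measurable M" by fact
    show "s n \<in> borel_measurable M" for n
      using int[of "a + X (n + N)"] int[of a] N[of "n + N"] e unfolding s_def
      by (auto intro!: borel_measurable_divide borel_measurable_diff borel_measurable_integrable)
    show "integrable M w" by fact
    show "AE z in M. (\<lambda>n. s n z) \<longlonglongrightarrow> F' a z"
    proof (rule AE_I2)
      fix z assume z: "z \<in> space M"
      have "((\<lambda>h. (F (a + h) z - F a z) / h) \<longlongrightarrow> F' a z) (at 0)"
        using der[of a z] z e by (simp add: DERIV_def)
      then have "(\<lambda>n. (F (a + X n) z - F a z) / X n) \<longlonglongrightarrow> F' a z"
        unfolding tendsto_at_iff_sequentially using X lim by (auto simp: comp_def)
      then show "(\<lambda>n. s n z) \<longlonglongrightarrow> F' a z" unfolding s_def by (rule LIMSEQ_ignore_initial_segment)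
    qed
    show "AE z in M. norm (s n z) \<le> w z" for n
    proof (rule AE_I2)
      fix z assume z: "z \<in> space M"
      define h where "h = X (n + N)"
      have h: "\<bar>h\<bar> < e" "h \<noteq> 0" using N[of "n + N"] nz by (auto simp: h_def)
      have "\<exists>\<xi>. \<bar>\<xi> - a\<bar> < e \<and> F (a + h) z - F a z = h * F' \<xi> z"
      proof (cases "h > 0")
        case True
        have "\<exists>\<xi>. a < \<xi> \<and> \<xi> < a + h \<and> F (a + h) z - F a z = (a + h - a) * F' \<xi> z"
          using True h z by (intro MVT2 der) auto
        then obtain \<xi> where \<xi>: "a < \<xi>" "\<xi> < a + h" "F (a + h) z - F a z = (a + h - a) * F' \<xi> z" by blast
        then have "\<bar>\<xi> - a\<bar> < e" "F (a + h) z - F a z = h * F' \<xi> z" using True h by auto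
        then show ?thesis by blast
      next
        case False
        have "\<exists>\<xi>. a + h < \<xi> \<and> \<xi> < a \<and> F a z - F (a + h) z = (a - (a + h)) * F' \<xi> z"
          using False h z by (intro MVT2 der) auto
        then obtain \<xi> where \<xi>: "a + h < \<xi>" "\<xi> < a" "F a z - F (a + h) z = (a - (a + h)) * F' \<xi> z" by blast
        then have "\<bar>\<xi> - a\<bar> < e" "F (a + h) z - F a z = h * F' \<xi> z" using False h by auto
        then show ?thesis by blast
      qed
      then obtain \<xi> where "\<bar>\<xi> - a\<bar> < e" "s n z = F' \<xi> z"
        using h by (auto simp: s_def h_def[symmetric])
      then show "norm (s n z) \<le> w z" using dom[of \<xi> z] z by simp
    qed
  qed
  moreover have "(\<integral>z. s n z \<partial>M) = ((\<integral>z. F (a + X (n + N)) z \<partial>M) - (\<integral>z. F a z \<partial>M)) / X (n + N)" for n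
    using int[of "a + X (n + N)"] int[of a] N[of "n + N"] e unfolding s_def by simp
  ultimately have "(\<lambda>n. ((\<integral>z. F (a + X (n + N)) z \<partial>M) - (\<integral>z. F a z \<partial>M)) / X (n + N)) \<longlonglongrightarrow> (\<integral>z. F' a z \<partial>M)"
    by simp
  then have "(\<lambda>n. ((\<integral>z. F (a + X n) z \<partial>M) - (\<integral>z. F a z \<partial>M)) / X n) \<longlonglongrightarrow> (\<integral>z. F' a z \<partial>M)"
    by (rule LIMSEQ_offset)
  then show "((\<lambda>h. ((\<integral>z. F (a + h) z \<partial>M) - (\<integral>z. F a z \<partial>M)) / h) \<circ> X) \<longlonglongrightarrow> (\<integral>z. F' a z \<partial>M)"
    by (simp add: comp_def)
qed

section \<open>Gaussian profiles: moments and decay\<close>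

lemma integrable_gaussian:
  fixes c :: real assumes "c > 0"
  shows "integrable lborel (\<lambda>y. exp (- ((y - x)\<^sup>2) / c))"
proof -
  have "exp (- ((y - x)\<^sup>2) / c) = sqrt (pi * c) * normal_density x (sqrt (c / 2)) y" for y
    using assms by (simp add: normal_density_def)
  then show ?thesis using assms by (simp only:) (intro integrable_mult_right integrable_normal_density, simp)
qed

text \<open>Minus the first derivative of the normal density; \<open>gauss2\<close> below is its
  second derivative. With these signs each x-derivative of a kernel
  \<open>q ((y - x) / s) / s\<close> moves to the next profile and produces the factor
  \<open>1 / s\<close> with a plus sign.\<close>

definition gauss1 :: "real \<Rightarrow> real" where "gauss1 z = z * std_normal_density z"

definition gauss2 :: "real \<Rightarrow> real" where "gauss2 z = (z\<^sup>2 - 1) * std_normal_density z"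

text \<open>\<open>gauss_avg q s f x\<close> is the convolution of \<open>f\<close> with the rescaled profile \<open>q\<close>, evaluated at
  \<open>x\<close>. It makes sense at \<open>s = 0\<close>, and for \<open>q = std_normal_density\<close>, \<open>s = sqrt (2 r)\<close> it is the
  heat semigroup at time \<open>r\<close>.\<close>

definition gauss_avg :: "(real \<Rightarrow> real) \<Rightarrow> real \<Rightarrow> (real \<Rightarrow> real) \<Rightarrow> real \<Rightarrow> real" where
  "gauss_avg q s f x = (\<integral>z. f (x + s * z) * q z \<partial>lborel)"

lemma measurable_gauss1[measurable]: "gauss1 \<in> borel_measurable borel"
  unfolding gauss1_def[abs_def] by measurable

lemma measurable_gauss2[measurable]: "gauss2 \<in> borel_measurable borel"
  unfolding gauss2_def[abs_def] by measurable

lemma integrable_gauss1: "integrable lborel gauss1"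
  using integrable_std_normal_moment[of 1] unfolding gauss1_def[abs_def] by (simp add: mult.commute)

lemma integrable_gauss2: "integrable lborel gauss2"
proof -
  have "integrable lborel (\<lambda>z. std_normal_density z * z ^ 2 - std_normal_density z)"
    using integrable_std_normal_moment[of 2] by (intro Bochner_Integration.integrable_diff) auto
  then show ?thesis unfolding gauss2_def[abs_def] by (simp add: algebra_simps)
qed

text \<open>The standard normal distribution has variance 1. This cancellation is what tames the
  second derivative of the heat kernel.\<close>

lemma integral_gauss2: "(\<integral>z. gauss2 z \<partial>lborel) = 0"
proof -
  have "(\<integral>z. gauss2 z \<partial>lborel) = (\<integral>z. std_normal_density z * z ^ 2 - std_normal_density z \<partial>lborel)"
    by (simp add: gauss2_def algebra_simps)
  also have "\<dots> = (\<integral>z. std_normal_density z * z ^ 2 \<partial>lborel) - (\<integral>z. std_normal_density z \<partial>lborel)"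
    using integrable_std_normal_moment[of 2] by (intro Bochner_Integration.integral_diff) auto
  also have "\<dots> = 0" using integral_std_normal_moment_even[of 1] by (simp add: fact_numeral)
  finally show ?thesis .
qed

text \<open>The weight is what a Hoelder increment of order 1/2 leaves after rescaling. Dominating
  everything by the polynomial \<open>(1 + z\<^sup>2)\<^sup>2\<close> reduces the claim to normal
  moments of orders 2 and 4.\<close>

lemma integrable_sqrt_gauss2: "integrable lborel (\<lambda>z. sqrt \<bar>z\<bar> * \<bar>gauss2 z\<bar>)"
proof (rule Bochner_Integration.integrable_bound)
  have "integrable lborel (\<lambda>z. std_normal_density z + 2 * (std_normal_density z * z ^ 2) + std_normal_density z * z ^ 4)"
    using integrable_std_normal_moment[of 2] integrable_std_normal_moment[of 4]
    by (intro Bochner_Integration.integrable_add integrable_mult_right) auto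
  then show "integrable lborel (\<lambda>z. std_normal_density z * (1 + z\<^sup>2)\<^sup>2)"
    by (simp add: power2_eq_square algebra_simps power4_eq_xxxx)
  show "AE z in lborel. norm (sqrt \<bar>z\<bar> * \<bar>gauss2 z\<bar>) \<le> norm (std_normal_density z * (1 + z\<^sup>2)\<^sup>2)"
  proof (rule AE_I2)
    fix z :: real
    have "\<bar>z\<bar> \<le> (1 + z\<^sup>2)\<^sup>2"
    proof -
      have "0 \<le> (\<bar>z\<bar> - 1/2)\<^sup>2" by simp
      then have "\<bar>z\<bar> \<le> 1 + z\<^sup>2" by (simp add: power2_eq_square algebra_simps)
      also have "\<dots> \<le> (1 + z\<^sup>2)\<^sup>2" by (intro self_le_power) auto
      finally show ?thesis .
    qed
    then have "sqrt \<bar>z\<bar> \<le> 1 + z\<^sup>2" by (intro real_le_lsqrt) auto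
    moreover have "\<bar>z\<^sup>2 - 1\<bar> \<le> 1 + z\<^sup>2" by (auto simp: abs_le_iff intro: order_trans[of _ 0])
    ultimately have "sqrt \<bar>z\<bar> * \<bar>z\<^sup>2 - 1\<bar> \<le> (1 + z\<^sup>2) * (1 + z\<^sup>2)" by (intro mult_mono) auto
    then have "std_normal_density z * (sqrt \<bar>z\<bar> * \<bar>z\<^sup>2 - 1\<bar>) \<le> std_normal_density z * ((1 + z\<^sup>2) * (1 + z\<^sup>2))"
      by (intro mult_left_mono) auto
    then show "norm (sqrt \<bar>z\<bar> * \<bar>gauss2 z\<bar>) \<le> norm (std_normal_density z * (1 + z\<^sup>2)\<^sup>2)"
      by (simp add: gauss2_def abs_mult power2_eq_square mult_ac)
  qed
qed measurable

lemma std_normal_density_le: "std_normal_density z \<le> exp (- (z\<^sup>2) / 2)"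
proof -
  have "1 \<le> sqrt (2 * pi)" using pi_gt3 by simp
  then show ?thesis by (simp add: std_normal_density_def divide_le_eq mult_le_cancel_left1)
qed

text \<open>Half of the Gaussian exponent is spent on absorbing the polynomial factor, through 1 + y
  \<le> exp y.\<close>

lemma quadratic_gaussian_le: "(1 + z\<^sup>2) * exp (- (z\<^sup>2) / 2) \<le> 5 * exp (- (z\<^sup>2) / 4)" for z :: real
proof -
  have "1 + z\<^sup>2 \<le> 5 * (1 + z\<^sup>2 / 4)" by (simp add: field_simps)
  also have "\<dots> \<le> 5 * exp (z\<^sup>2 / 4)" by (intro mult_left_mono exp_ge_add_one_self) auto
  finally have "(1 + z\<^sup>2) * exp (- (z\<^sup>2) / 2) \<le> 5 * exp (z\<^sup>2 / 4) * exp (- (z\<^sup>2) / 2)"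
    by (intro mult_right_mono) auto
  also have "\<dots> = 5 * exp (- (z\<^sup>2) / 4)" by (simp flip: exp_add)
  finally show ?thesis .
qed

lemma gauss1_bound: "\<bar>gauss1 z\<bar> \<le> 5 * exp (- (z\<^sup>2) / 4)"
proof -
  have "0 \<le> (\<bar>z\<bar> - 1/2)\<^sup>2" by simp
  then have "\<bar>z\<bar> \<le> 1 + z\<^sup>2" by (simp add: power2_eq_square algebra_simps)
  then have "\<bar>gauss1 z\<bar> \<le> (1 + z\<^sup>2) * exp (- (z\<^sup>2) / 2)"
    unfolding gauss1_def abs_mult using std_normal_density_le[of z] by (intro mult_mono) auto
  then show ?thesis using quadratic_gaussian_le[of z] by linarith
qed

lemma gauss2_bound: "\<bar>gauss2 z\<bar> \<le> 5 * exp (- (z\<^sup>2) / 4)"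
proof -
  have "\<bar>z\<^sup>2 - 1\<bar> \<le> 1 + z\<^sup>2" by (auto simp: abs_le_iff intro: order_trans[of _ 0])
  then have "\<bar>gauss2 z\<bar> \<le> (1 + z\<^sup>2) * exp (- (z\<^sup>2) / 2)"
    unfolding gauss2_def abs_mult using std_normal_density_le[of z] by (intro mult_mono) auto
  then show ?thesis using quadratic_gaussian_le[of z] by linarith
qed

lemma std_normal_density_deriv: "(std_normal_density has_real_derivative - gauss1 z) (at z)"
  unfolding std_normal_density_def[abs_def] gauss1_def
  by (rule derivative_eq_intros refl | simp add: std_normal_density_def)+

lemma gauss1_deriv: "(gauss1 has_real_derivative - gauss2 z) (at z)"
  unfolding gauss1_def[abs_def]
  by (rule derivative_eq_intros std_normal_density_deriv refl)+
    (simp add: gauss2_def gauss1_def algebra_simps power2_eq_square)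

text \<open>The substitution y = x + s z moves the parameters from \<open>f\<close>, which is only
  continuous, to the smooth profile, where derivatives can be taken.\<close>

lemma gauss_avg_kernel:
  assumes "s > 0"
  shows "gauss_avg q s f x = (\<integral>y. f y * (q ((y - x) / s) / s) \<partial>lborel)"
  unfolding gauss_avg_def
  using assms by (subst lborel_integral_real_affine[where c = s and t = x and f = "\<lambda>y. f y * (q ((y - x) / s) / s)"]) simp_all

lemma gauss_avg_integrable:
  fixes f q :: "real \<Rightarrow> real"
  assumes f: "continuous_on UNIV f" "\<And>x. \<bar>f x\<bar> \<le> M" and q: "integrable lborel q"
  shows "integrable lborel (\<lambda>z. f (x + s * z) * q z)"
proof (rule Bochner_Integration.integrable_bound)
  have [measurable]: "f \<in> borel_measurable borel" using f(1) by (rule borel_measurable_continuous_onI)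
  have [measurable]: "q \<in> borel_measurable borel" using borel_measurable_integrable[OF q] by simp
  show "(\<lambda>z. f (x + s * z) * q z) \<in> borel_measurable lborel" by measurable
  show "integrable lborel (\<lambda>z. M * q z)" using q by simp
  have "\<bar>f y\<bar> \<le> \<bar>M\<bar>" for y using f(2)[of y] by linarith
  then show "AE z in lborel. norm (f (x + s * z) * q z) \<le> norm (M * q z)"
    by (intro AE_I2) (simp add: abs_mult mult_right_mono)
qed

lemma gauss_avg_bound:
  assumes f: "continuous_on UNIV f" "\<And>x. \<bar>f x\<bar> \<le> M" and q: "integrable lborel q"
  shows "\<bar>gauss_avg q s f x\<bar> \<le> M * (\<integral>z. \<bar>q z\<bar> \<partial>lborel)"
proof -
  have "\<bar>gauss_avg q s f x\<bar> \<le> (\<integral>z. \<bar>f (x + s * z) * q z\<bar> \<partial>lborel)"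
    unfolding gauss_avg_def using integral_norm_bound[of lborel "\<lambda>z. f (x + s * z) * q z"] by simp
  also have "\<dots> \<le> (\<integral>z. M * \<bar>q z\<bar> \<partial>lborel)"
  proof (rule integral_mono)
    show "integrable lborel (\<lambda>z. \<bar>f (x + s * z) * q z\<bar>)" by (intro integrable_abs gauss_avg_integrable[OF f q])
    show "integrable lborel (\<lambda>z. M * \<bar>q z\<bar>)" using q by (intro integrable_mult_right integrable_abs)
    show "\<bar>f (x + s * z) * q z\<bar> \<le> M * \<bar>q z\<bar>" for z
      unfolding abs_mult using f(2) by (intro mult_right_mono) auto
  qed
  finally show ?thesis by simp
qed

text \<open>Dominated convergence with majorant \<open>\<bar>M * q z\<bar>\<close>. The scale may
  tend to 0, and this is how the heat semigroup attains its initial values.\<close>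

lemma gauss_avg_tendsto:
  fixes g :: "real \<Rightarrow> real \<Rightarrow> real"
  assumes g: "continuous_on UNIV (\<lambda>(t, x). g t x)" "\<And>t x. \<bar>g t x\<bar> \<le> M" and q: "integrable lborel q"
    and lim: "s \<longlonglongrightarrow> s0" "t \<longlonglongrightarrow> t0" "x \<longlonglongrightarrow> x0"
  shows "(\<lambda>n. gauss_avg q (s n) (g (t n)) (x n)) \<longlonglongrightarrow> gauss_avg q s0 (g t0) x0"
  unfolding gauss_avg_def
proof (rule integral_dominated_convergence[where w = "\<lambda>z. \<bar>M * q z\<bar>"])
  have c: "continuous_on UNIV (g t)" for t
    using continuous_on_compose2[OF g(1), of UNIV "\<lambda>x. (t, x)"] by (simp add: continuous_on_Pair)
  have int: "integrable lborel (\<lambda>z. g t (x + s * z) * q z)" for t x s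
    by (rule gauss_avg_integrable[OF c g(2) q])
  show "(\<lambda>z. g t0 (x0 + s0 * z) * q z) \<in> borel_measurable lborel" using int by (rule borel_measurable_integrable)
  show "(\<lambda>z. g (t n) (x n + s n * z) * q z) \<in> borel_measurable lborel" for n
    using int by (rule borel_measurable_integrable)
  show "integrable lborel (\<lambda>z. \<bar>M * q z\<bar>)" using q by simp
  show "AE z in lborel. (\<lambda>n. g (t n) (x n + s n * z) * q z) \<longlonglongrightarrow> g t0 (x0 + s0 * z) * q z"
  proof (rule AE_I2)
    fix z
    have "(\<lambda>n. (\<lambda>(t, x). g t x) (t n, x n + s n * z)) \<longlonglongrightarrow> (\<lambda>(t, x). g t x) (t0, x0 + s0 * z)"
      using g(1) by (rule continuous_on_tendsto_compose) (auto intro!: tendsto_intros lim)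
    then show "(\<lambda>n. g (t n) (x n + s n * z) * q z) \<longlonglongrightarrow> g t0 (x0 + s0 * z) * q z"
      by (auto intro!: tendsto_intros)
  qed
  have "\<bar>g t y\<bar> \<le> \<bar>M\<bar>" for t y using g(2)[of t y] by linarith
  then show "AE z in lborel. norm (g (t n) (x n + s n * z) * q z) \<le> \<bar>M * q z\<bar>" for n
    by (intro AE_I2) (simp add: abs_mult mult_right_mono)
qed

text \<open>Stated for a general profile because it is used twice, from the normal density to
  \<open>gauss1\<close> and from \<open>gauss1\<close> to \<open>gauss2\<close>.\<close>

lemma gauss_avg_deriv_x:
  assumes f: "continuous_on UNIV f" "\<And>x. \<bar>f x\<bar> \<le> M" and q: "integrable lborel q"
    and q': "\<And>z. (q has_real_derivative q' z) (at z)" "\<And>z. \<bar>q' z\<bar> \<le> C * exp (- (z\<^sup>2) / 4)"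
      "q' \<in> borel_measurable borel"
    and s: "s > 0"
  shows "((\<lambda>x. gauss_avg q s f x) has_real_derivative - gauss_avg q' s f x / s) (at x)"
proof -
  have [measurable]: "f \<in> borel_measurable borel" using f(1) by (rule borel_measurable_continuous_onI)
  have [measurable]: "q' \<in> borel_measurable borel" by fact
  have M: "M \<ge> 0" using f(2)[of 0] by linarith
  have C: "C \<ge> 0" using q'(2)[of 0] by simp
  have "((\<lambda>x. \<integral>y. f y * (q ((y - x) / s) / s) \<partial>lborel) has_real_derivative
      (\<integral>y. f y * (- q' ((y - x) / s) / s / s) \<partial>lborel)) (at x)"
  proof (rule has_real_derivative_integral_dominated[where e = 1
        and w = "\<lambda>y. M * (C * (exp (1 / (4 * s\<^sup>2)) * exp (- ((y - x)\<^sup>2) / (8 * s\<^sup>2))) / s / s)"])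
    show "integrable lborel (\<lambda>y. f y * (q ((y - x') / s) / s))" for x'
    proof -
      have "integrable lborel (\<lambda>z. f z * (q ((z - x') / s) / s))"
        using gauss_avg_integrable[OF f q, of x' s] s
        by (subst lborel_integrable_real_affine_iff[where c = s and t = x', symmetric]) auto
      then show ?thesis .
    qed
    show "((\<lambda>x. f z * (q ((z - x) / s) / s)) has_real_derivative f z * (- q' ((z - y) / s) / s / s)) (at y)" for y z
      using s by (auto intro!: derivative_eq_intros DERIV_chain2[OF q'(1)] simp: field_simps)
    show "\<bar>f z * (- q' ((z - y) / s) / s / s)\<bar>
      \<le> M * (C * (exp (1 / (4 * s\<^sup>2)) * exp (- ((z - x)\<^sup>2) / (8 * s\<^sup>2))) / s / s)" if y: "\<bar>y - x\<bar> < 1" for y z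
    proof -
      \<comment> \<open>The majorant must not depend on the moving centre \<open>y\<close>. The
        parallelogram identity recentres the Gaussian at \<open>x\<close>, at the price of half the
        rate and the constant \<open>exp (1 / (4 * s\<^sup>2))\<close>.\<close>
      have "(y - x)\<^sup>2 \<le> 1" using y by (simp add: abs_square_le_1)
      moreover have "0 \<le> ((z - y) - (y - x))\<^sup>2" by simp
      ultimately have "(z - x)\<^sup>2 \<le> 2 * (z - y)\<^sup>2 + 2"
        by (simp add: power2_eq_square algebra_simps)
      then have "- ((z - y)\<^sup>2) \<le> 1 - (z - x)\<^sup>2 / 2" by linarith
      then have "- ((z - y)\<^sup>2) / (4 * s\<^sup>2) \<le> (1 - (z - x)\<^sup>2 / 2) / (4 * s\<^sup>2)"
        by (intro divide_right_mono) auto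
      then have "- (((z - y) / s)\<^sup>2) / 4 \<le> 1 / (4 * s\<^sup>2) + - ((z - x)\<^sup>2) / (8 * s\<^sup>2)"
        using s by (simp add: power_divide field_simps)
      then have "exp (- (((z - y) / s)\<^sup>2) / 4) \<le> exp (1 / (4 * s\<^sup>2)) * exp (- ((z - x)\<^sup>2) / (8 * s\<^sup>2))"
        by (simp only: exp_le_cancel_iff flip: exp_add)
      then have "\<bar>q' ((z - y) / s)\<bar> \<le> C * (exp (1 / (4 * s\<^sup>2)) * exp (- ((z - x)\<^sup>2) / (8 * s\<^sup>2)))"
        using q'(2)[of "(z - y) / s"] C by (meson mult_left_mono order_trans)
      then show ?thesis using s M f(2)[of z] unfolding abs_mult
        by (intro mult_mono) (auto simp: abs_mult intro!: divide_right_mono)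
    qed
    show "integrable lborel (\<lambda>y. M * (C * (exp (1 / (4 * s\<^sup>2)) * exp (- ((y - x)\<^sup>2) / (8 * s\<^sup>2))) / s / s))"
      using s by (intro integrable_mult_right integrable_divide integrable_gaussian) auto
    show "(\<lambda>y. f y * (- q' ((y - x) / s) / s / s)) \<in> borel_measurable lborel" by measurable
  qed simp
  moreover have "(\<integral>y. f y * (- q' ((y - x) / s) / s / s) \<partial>lborel) = - gauss_avg q' s f x / s"
    unfolding gauss_avg_kernel[OF s] by (simp flip: integral_minus integral_divide_zero add: field_simps)
  ultimately show ?thesis unfolding gauss_avg_kernel[OF s] by simp
qed

text \<open>The heat equation in the variable s: the kernel K_s(x) with normal profile satisfies
  dK/ds = s K_xx, because differentiating the profile and the prefactor 1/s together yields z^2 -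
  1.\<close>

lemma gauss_avg_deriv_s:
  assumes f: "continuous_on UNIV f" "\<And>x. \<bar>f x\<bar> \<le> M" and s: "s > 0"
  shows "((\<lambda>s. gauss_avg std_normal_density s f x) has_real_derivative gauss_avg gauss2 s f x / s) (at s)"
proof -
  have [measurable]: "f \<in> borel_measurable borel" using f(1) by (rule borel_measurable_continuous_onI)
  have M: "M \<ge> 0" using f(2)[of 0] by linarith
  have deriv: "((\<lambda>s. \<integral>y. f y * (std_normal_density ((y - x) / s) / s) \<partial>lborel) has_real_derivative
      (\<integral>y. f y * (gauss2 ((y - x) / s) / s / s) \<partial>lborel)) (at s)"
  \<comment> \<open>The radius \<open>s / 2\<close> keeps the scale \<open>r\<close> between
    \<open>s / 2\<close> and \<open>2 * s\<close>. The upper limit gives the Gaussian rate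
    \<open>16 * s\<^sup>2\<close>, the lower one the factor \<open>4 / s\<^sup>2\<close>.\<close>
  proof (rule has_real_derivative_integral_dominated[where e = "s / 2"
        and w = "\<lambda>y. M * (5 * exp (- ((y - x)\<^sup>2) / (16 * s\<^sup>2)) * (4 / s\<^sup>2))"])
    show "s / 2 > 0" using s by simp
    fix r assume r: "\<bar>r - s\<bar> < s / 2"
    then have r0: "r > 0" "s / 2 < r" "r < 2 * s" using s by linarith+
    show "integrable lborel (\<lambda>y. f y * (std_normal_density ((y - x) / r) / r))"
    proof -
      have "integrable lborel (\<lambda>z. f (x + r * z) * std_normal_density z)"
        by (rule gauss_avg_integrable[OF f]) simp
      then have "integrable lborel (\<lambda>z. f (x + r * z) * (std_normal_density ((x + r * z - x) / r) / r))"
        using r0 by simp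
      then show ?thesis
        using r0 by (subst lborel_integrable_real_affine_iff[where c = r and t = x, symmetric]) auto
    qed
    show "((\<lambda>s. f z * (std_normal_density ((z - x) / s) / s)) has_real_derivative f z * (gauss2 ((z - x) / r) / r / r)) (at r)" for z
    proof -
      have "((\<lambda>s. std_normal_density ((z - x) / s)) has_real_derivative - gauss1 ((z - x) / r) * (- (z - x) / r\<^sup>2)) (at r)"
        using r0 by (intro DERIV_chain2[OF std_normal_density_deriv])
          (auto intro!: derivative_eq_intros simp: power2_eq_square)
      then have "((\<lambda>s. f z * (std_normal_density ((z - x) / s) / s)) has_real_derivative
         f z * (((- gauss1 ((z - x) / r) * (- (z - x) / r\<^sup>2)) * r - std_normal_density ((z - x) / r) * 1) / (r * r))) (at r)"
        using r0 by (intro DERIV_cmult DERIV_divide DERIV_ident) auto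
      moreover have "((- gauss1 ((z - x) / r) * (- (z - x) / r\<^sup>2)) * r - std_normal_density ((z - x) / r) * 1) / (r * r)
        = gauss2 ((z - x) / r) / r / r"
        using r0 unfolding gauss1_def gauss2_def by (simp add: field_simps power2_eq_square)
      ultimately show ?thesis by (simp only:)
    qed
    show "\<bar>f z * (gauss2 ((z - x) / r) / r / r)\<bar> \<le> M * (5 * exp (- ((z - x)\<^sup>2) / (16 * s\<^sup>2)) * (4 / s\<^sup>2))" for z
    proof -
      have "r\<^sup>2 \<le> (2 * s)\<^sup>2" using r0 by (intro power_mono) auto
      then have "(z - x)\<^sup>2 / (16 * s\<^sup>2) \<le> (z - x)\<^sup>2 / (4 * r\<^sup>2)"
        using r0 s by (intro divide_left_mono) auto
      then have "exp (- (((z - x) / r)\<^sup>2) / 4) \<le> exp (- ((z - x)\<^sup>2) / (16 * s\<^sup>2))"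
        by (simp add: power_divide mult.commute)
      then have 1: "\<bar>gauss2 ((z - x) / r)\<bar> \<le> 5 * exp (- ((z - x)\<^sup>2) / (16 * s\<^sup>2))"
        using gauss2_bound[of "(z - x) / r"] by linarith
      have "(s / 2)\<^sup>2 \<le> r\<^sup>2" using r0 s by (intro power_mono) auto
      then have "1 / r\<^sup>2 \<le> 4 / s\<^sup>2" using r0 s by (simp add: field_simps)
      with 1 have "\<bar>gauss2 ((z - x) / r)\<bar> * (1 / r\<^sup>2) \<le> 5 * exp (- ((z - x)\<^sup>2) / (16 * s\<^sup>2)) * (4 / s\<^sup>2)"
        by (intro mult_mono) auto
      moreover have "\<bar>gauss2 ((z - x) / r) / r / r\<bar> = \<bar>gauss2 ((z - x) / r)\<bar> * (1 / r\<^sup>2)"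
        using r0 by (simp add: abs_mult power2_eq_square)
      ultimately show ?thesis using f(2)[of z] M unfolding abs_mult by (intro mult_mono) auto
    qed
  next
    show "integrable lborel (\<lambda>y. M * (5 * exp (- ((y - x)\<^sup>2) / (16 * s\<^sup>2)) * (4 / s\<^sup>2)))"
      using s by (intro integrable_mult_right integrable_mult_left integrable_gaussian) auto
    show "(\<lambda>y. f y * (gauss2 ((y - x) / s) / s / s)) \<in> borel_measurable lborel" by measurable
  qed
  have eq: "(\<integral>y. f y * (gauss2 ((y - x) / s) / s / s) \<partial>lborel) = gauss_avg gauss2 s f x / s"
    unfolding gauss_avg_kernel[OF s] by (simp flip: integral_divide_zero add: field_simps)
  have ev: "\<forall>\<^sub>F r in nhds s. (\<integral>y. f y * (std_normal_density ((y - x) / r) / r) \<partial>lborel) = gauss_avg std_normal_density r f x"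
    using eventually_nhds_in_open[of "{0<..}" s] s by (auto elim!: eventually_mono simp: gauss_avg_kernel)
  show ?thesis using deriv unfolding eq by (rule DERIV_cong_ev[OF refl ev refl, THEN iffD1])
qed

text \<open>\<open>heat0 r f\<close> is the heat semigroup applied to \<open>f\<close>; \<open>heat1\<close> and \<open>heat2\<close> are its first and
  second spatial derivatives for \<open>r > 0\<close>.\<close>

definition heat0 :: "real \<Rightarrow> (real \<Rightarrow> real) \<Rightarrow> real \<Rightarrow> real" where
  "heat0 r f x = gauss_avg std_normal_density (sqrt (2 * r)) f x"

definition heat1 :: "real \<Rightarrow> (real \<Rightarrow> real) \<Rightarrow> real \<Rightarrow> real" where
  "heat1 r f x = gauss_avg gauss1 (sqrt (2 * r)) f x / sqrt (2 * r)"

definition heat2 :: "real \<Rightarrow> (real \<Rightarrow> real) \<Rightarrow> real \<Rightarrow> real" where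
  "heat2 r f x = gauss_avg gauss2 (sqrt (2 * r)) f x / (2 * r)"

section \<open>Bounds and derivatives of the heat semigroup\<close>

lemma heat0_0 [simp]: "heat0 0 f x = f x"
  by (simp add: heat0_def gauss_avg_def)

lemma heat0_bound:
  assumes "continuous_on UNIV f" "\<And>x. \<bar>f x\<bar> \<le> M"
  shows "\<bar>heat0 r f x\<bar> \<le> M"
proof -
  have "(\<integral>z. \<bar>std_normal_density z\<bar> \<partial>lborel) = 1" by simp
  then show ?thesis
    using gauss_avg_bound[OF assms, of std_normal_density "sqrt (2 * r)" x] by (simp add: heat0_def)
qed

lemma heat0_diff:
  assumes f: "continuous_on UNIV f" "\<And>x. \<bar>f x\<bar> \<le> M" and g: "continuous_on UNIV g" "\<And>x. \<bar>g x\<bar> \<le> N"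
  shows "heat0 r (\<lambda>x. f x - g x) x = heat0 r f x - heat0 r g x"
  unfolding heat0_def gauss_avg_def left_diff_distrib
  by (intro Bochner_Integration.integral_diff gauss_avg_integrable[OF f] gauss_avg_integrable[OF g]) auto

text \<open>The semigroup commutes with translations and does not increase sup norms, so the sup
  bound is applied to \<open>f\<close> minus its translate by \<open>y - x\<close>.\<close>

lemma heat0_lipschitz:
  assumes f: "continuous_on UNIV f" "\<And>x. \<bar>f x\<bar> \<le> M" and lip: "\<And>x y. \<bar>f x - f y\<bar> \<le> L * \<bar>x - y\<bar>"
  shows "\<bar>heat0 r f x - heat0 r f y\<bar> \<le> L * \<bar>x - y\<bar>"
proof -
  have shift: "heat0 r f y = heat0 r (\<lambda>z. f (z + (y - x))) x"
    unfolding heat0_def gauss_avg_def by (simp add: algebra_simps)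
  have c: "continuous_on UNIV (\<lambda>z. f (z + (y - x)))"
    by (rule continuous_on_compose2[OF f(1)]) (auto intro!: continuous_intros)
  have "\<bar>heat0 r (\<lambda>z. f z - f (z + (y - x))) x\<bar> \<le> L * \<bar>x - y\<bar>"
  proof (rule heat0_bound)
    show "continuous_on UNIV (\<lambda>z. f z - f (z + (y - x)))" using f(1) c by (intro continuous_intros)
    show "\<bar>f z - f (z + (y - x))\<bar> \<le> L * \<bar>x - y\<bar>" for z
      using lip[of z "z + (y - x)"] by (simp add: abs_minus_commute)
  qed
  then show ?thesis unfolding shift using heat0_diff[OF f c f(2), where r = r and x = x] by simp
qed

definition heat1_const :: real where "heat1_const = (\<integral>z. \<bar>gauss1 z\<bar> \<partial>lborel)"

definition heat2_const :: real where "heat2_const = (\<integral>z. sqrt \<bar>z\<bar> * \<bar>gauss2 z\<bar> \<partial>lborel)"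

lemma heat_const_nonneg: "heat1_const \<ge> 0" "heat2_const \<ge> 0"
  by (auto simp: heat1_const_def heat2_const_def)

text \<open>One space derivative costs \<open>r powr (- 1 / 2)\<close>, integrable at 0 for every
  bounded source; the harmless factor 1 / sqrt 2 is dropped.\<close>

lemma heat1_bound:
  assumes f: "continuous_on UNIV f" "\<And>x. \<bar>f x\<bar> \<le> M" and r: "r > 0"
  shows "\<bar>heat1 r f x\<bar> \<le> M * heat1_const * r powr (- 1 / 2)"
proof -
  have M: "M \<ge> 0" using f(2)[of 0] by linarith
  have "\<bar>gauss_avg gauss1 (sqrt (2 * r)) f x\<bar> \<le> M * heat1_const"
    unfolding heat1_const_def by (rule gauss_avg_bound[OF f integrable_gauss1])
  then have "\<bar>heat1 r f x\<bar> \<le> M * heat1_const / sqrt (2 * r)"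
    using r by (simp add: heat1_def divide_right_mono)
  also have "\<dots> \<le> M * heat1_const / sqrt r"
    using r M heat_const_nonneg by (intro divide_left_mono) auto
  also have "\<dots> = M * heat1_const * r powr (- 1 / 2)"
    using r by (simp add: powr_minus_divide powr_half_sqrt)
  finally show ?thesis .
qed

text \<open>Since \<open>gauss2\<close> has integral zero, \<open>f\<close> may be replaced by \<open>f - f x\<close>; this gains the factor
  \<open>r powr (1 / 4)\<close> that makes the singularity at \<open>r = 0\<close> integrable.\<close>

lemma heat2_bound:
  assumes f: "continuous_on UNIV f" "\<And>x. \<bar>f x\<bar> \<le> M"
    and hoelder: "\<And>x y. \<bar>f x - f y\<bar> \<le> K * sqrt \<bar>x - y\<bar>" and r: "r > 0"
  shows "\<bar>heat2 r f x\<bar> \<le> K * heat2_const * r powr (- 3 / 4)"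
proof -
  have K: "K \<ge> 0" using hoelder[of 1 0] by simp
  define s where "s = sqrt (2 * r)"
  have s: "s > 0" "s\<^sup>2 = 2 * r" using r by (auto simp: s_def)
  have int: "integrable lborel (\<lambda>z. f (x + s * z) * gauss2 z)"
    by (rule gauss_avg_integrable[OF f integrable_gauss2])
  have "gauss_avg gauss2 s f x = (\<integral>z. f (x + s * z) * gauss2 z - f x * gauss2 z \<partial>lborel)"
    using int integrable_gauss2 integral_gauss2 by (simp add: gauss_avg_def)
  also have "\<bar>\<dots>\<bar> \<le> (\<integral>z. \<bar>f (x + s * z) * gauss2 z - f x * gauss2 z\<bar> \<partial>lborel)"
    using integral_norm_bound[of lborel "\<lambda>z. f (x + s * z) * gauss2 z - f x * gauss2 z"] by simp
  also have "\<dots> \<le> (\<integral>z. K * sqrt s * (sqrt \<bar>z\<bar> * \<bar>gauss2 z\<bar>) \<partial>lborel)"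
  proof (rule integral_mono)
    show "integrable lborel (\<lambda>z. \<bar>f (x + s * z) * gauss2 z - f x * gauss2 z\<bar>)"
      using int integrable_gauss2 by (intro integrable_abs Bochner_Integration.integrable_diff integrable_mult_right)
    show "integrable lborel (\<lambda>z. K * sqrt s * (sqrt \<bar>z\<bar> * \<bar>gauss2 z\<bar>))"
      by (intro integrable_mult_right integrable_sqrt_gauss2)
    show "\<bar>f (x + s * z) * gauss2 z - f x * gauss2 z\<bar> \<le> K * sqrt s * (sqrt \<bar>z\<bar> * \<bar>gauss2 z\<bar>)" for z
    proof -
      have "\<bar>f (x + s * z) * gauss2 z - f x * gauss2 z\<bar> = \<bar>f (x + s * z) - f x\<bar> * \<bar>gauss2 z\<bar>"
        by (simp flip: abs_mult left_diff_distrib)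
      also have "\<dots> \<le> K * sqrt \<bar>s * z\<bar> * \<bar>gauss2 z\<bar>"
        using hoelder[of "x + s * z" x] by (intro mult_right_mono) auto
      also have "\<dots> = K * sqrt s * (sqrt \<bar>z\<bar> * \<bar>gauss2 z\<bar>)"
        using s by (simp add: abs_mult real_sqrt_mult)
      finally show ?thesis .
    qed
  qed
  also have "\<dots> = K * heat2_const * sqrt s" by (simp add: heat2_const_def)
  finally have "\<bar>heat2 r f x\<bar> \<le> K * heat2_const * sqrt s / (2 * r)"
    unfolding heat2_def s_def[symmetric] using r by (simp add: divide_right_mono)
  \<comment> \<open>Here \<open>sqrt s\<close> is the power 1/4 of \<open>2 * r\<close>, and the
    kernel divides by \<open>2 * r\<close>.\<close>
  also have "\<dots> = K * heat2_const * (2 * r) powr (- 3 / 4)"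
  proof -
    have "sqrt s = (2 * r) powr (1 / 4)"
      using r by (simp add: s_def powr_powr flip: powr_half_sqrt)
    then have "sqrt s / (2 * r) = (2 * r) powr (1 / 4 - 1)"
      using r by (simp only: powr_diff powr_one)
    then show ?thesis by (simp add: times_divide_eq_right[symmetric] del: times_divide_eq_right)
  qed
  also have "\<dots> \<le> K * heat2_const * r powr (- 3 / 4)"
    using r K heat_const_nonneg by (intro mult_left_mono powr_mono2') auto
  finally show ?thesis .
qed

lemma heat0_deriv_x:
  assumes f: "continuous_on UNIV f" "\<And>x. \<bar>f x\<bar> \<le> M" and r: "r > 0"
  shows "((\<lambda>x. heat0 r f x) has_real_derivative heat1 r f x) (at x)"
proof -
  have neg: "- gauss_avg (\<lambda>z. - gauss1 z) s f x = gauss_avg gauss1 s f x" for s by (simp add: gauss_avg_def)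
  have "((\<lambda>x. gauss_avg std_normal_density (sqrt (2 * r)) f x) has_real_derivative
     - gauss_avg (\<lambda>z. - gauss1 z) (sqrt (2 * r)) f x / sqrt (2 * r)) (at x)"
    using r gauss1_bound
    by (intro gauss_avg_deriv_x[OF f _ std_normal_density_deriv, where C = 5]) auto
  then show ?thesis unfolding neg heat0_def heat1_def .
qed

lemma heat1_deriv_x:
  assumes f: "continuous_on UNIV f" "\<And>x. \<bar>f x\<bar> \<le> M" and r: "r > 0"
  shows "((\<lambda>x. heat1 r f x) has_real_derivative heat2 r f x) (at x)"
proof -
  have neg: "- gauss_avg (\<lambda>z. - gauss2 z) s f x = gauss_avg gauss2 s f x" for s by (simp add: gauss_avg_def)
  have "((\<lambda>x. gauss_avg gauss1 (sqrt (2 * r)) f x) has_real_derivative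
     - gauss_avg (\<lambda>z. - gauss2 z) (sqrt (2 * r)) f x / sqrt (2 * r)) (at x)"
    using r gauss2_bound
    by (intro gauss_avg_deriv_x[OF f integrable_gauss1 gauss1_deriv, where C = 5]) auto
  from DERIV_cdivide[OF this, of "sqrt (2 * r)"] show ?thesis
    using r unfolding neg heat1_def heat2_def by simp
qed

text \<open>With s = sqrt (2 r) one has ds/dr = 1/s, so the derivative in s becomes
  \<open>gauss2\<close> averaged and divided by \<open>2 * r\<close>, the same \<open>heat2\<close>
  that arises from two space derivatives.\<close>

lemma heat0_deriv_time:
  assumes f: "continuous_on UNIV f" "\<And>x. \<bar>f x\<bar> \<le> M" and r: "r > 0"
  shows "((\<lambda>r. heat0 r f x) has_real_derivative heat2 r f x) (at r)"
proof -
  have "((\<lambda>r. sqrt (2 * r)) has_real_derivative 1 / sqrt (2 * r)) (at r)"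
    using r by (auto intro!: derivative_eq_intros simp: field_simps)
  from DERIV_chain2[OF gauss_avg_deriv_s[OF f, of "sqrt (2 * r)"] this]
  have "((\<lambda>r. gauss_avg std_normal_density (sqrt (2 * r)) f x) has_real_derivative
     gauss_avg gauss2 (sqrt (2 * r)) f x / sqrt (2 * r) * (1 / sqrt (2 * r))) (at r)" using r by simp
  then show ?thesis using r unfolding heat0_def heat2_def by simp
qed

section \<open>Duhamel integrals\<close>

lemma integrable_powr_from_0:
  assumes "a > -1"
  shows "integrable lborel (\<lambda>r::real. indicator {0<..<T} r * r powr a)"
proof (rule Bochner_Integration.integrable_bound)
  have "(\<lambda>t. t powr a) integrable_on {0..max 0 T}"
    by (rule integrable_on_powr_from_0) (use assms in auto)
  then have "(\<lambda>t. t powr a) absolutely_integrable_on {0..max 0 T}"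
    by (subst absolutely_integrable_on_iff_nonneg) auto
  from this[unfolded set_integrable_def]
  show "integrable lborel (\<lambda>x. indicator {0..max 0 T} x *\<^sub>R (x powr a))"
    by (subst (asm) integrable_completion) auto
qed (auto simp: indicator_def)

text \<open>The operator is a parameter so that one theory serves \<open>heat0\<close>,
  \<open>heat1\<close> and \<open>heat2\<close>. Integrating over the elapsed time \<open>r\<close>
  fixes the kernel singularity at \<open>r = 0\<close> independently of \<open>t\<close>, and the
  indicator makes the integral vanish for nonpositive \<open>t\<close>.\<close>

definition duhamel :: "(real \<Rightarrow> (real \<Rightarrow> real) \<Rightarrow> real \<Rightarrow> real) \<Rightarrow> (real \<Rightarrow> real \<Rightarrow> real) \<Rightarrow> real \<Rightarrow> real \<Rightarrow> real" where
  "duhamel heat g t x = (\<integral>r. indicator {0<..<t} r * heat r (g (t - r)) x \<partial>lborel)"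

section \<open>Duhamel integrals of bounded continuous sources\<close>

locale bounded_source =
  fixes g :: "real \<Rightarrow> real \<Rightarrow> real" and M :: real
  assumes cont: "continuous_on UNIV (\<lambda>(t, x). g t x)" and bnd: "\<And>t x. \<bar>g t x\<bar> \<le> M"
begin

lemma M_nonneg: "M \<ge> 0" using bnd[of 0 0] by linarith

lemma cont1: "continuous_on UNIV (g t)"
  using continuous_on_compose2[OF cont, of UNIV "\<lambda>x. (t, x)"] by (simp add: continuous_on_Pair)

text \<open>The limit age \<open>r0\<close> is kept positive because \<open>heat1\<close> and
  \<open>heat2\<close> are singular at 0. The sequential form fits dominated convergence.\<close>

definition jointly_continuous :: "(real \<Rightarrow> (real \<Rightarrow> real) \<Rightarrow> real \<Rightarrow> real) \<Rightarrow> bool" where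
  "jointly_continuous heat \<longleftrightarrow> (\<forall>r t x r0 t0 x0. r \<longlonglongrightarrow> r0 \<longrightarrow> t \<longlonglongrightarrow> t0 \<longrightarrow> x \<longlonglongrightarrow> x0 \<longrightarrow> r0 > 0 \<longrightarrow>
      (\<lambda>n. heat (r n) (g (t n)) (x n)) \<longlonglongrightarrow> heat r0 (g t0) x0)"

lemma jointly_continuousD:
  "jointly_continuous heat \<Longrightarrow> r \<longlonglongrightarrow> r0 \<Longrightarrow> t \<longlonglongrightarrow> t0 \<Longrightarrow> x \<longlonglongrightarrow> x0 \<Longrightarrow> r0 > 0 \<Longrightarrow>
    (\<lambda>n. heat (r n) (g (t n)) (x n)) \<longlonglongrightarrow> heat r0 (g t0) x0"
  by (simp add: jointly_continuous_def)

lemma heat0_tendsto: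
  assumes "r \<longlonglongrightarrow> r0" "t \<longlonglongrightarrow> t0" "x \<longlonglongrightarrow> x0"
  shows "(\<lambda>n. heat0 (r n) (g (t n)) (x n)) \<longlonglongrightarrow> heat0 r0 (g t0) x0"
  unfolding heat0_def
  by (intro gauss_avg_tendsto[OF cont bnd] tendsto_intros assms) simp

lemma heat0_joint: "jointly_continuous heat0"
  by (simp add: jointly_continuous_def heat0_tendsto)

lemma heat1_joint: "jointly_continuous heat1"
  unfolding jointly_continuous_def heat1_def
  by (intro allI impI tendsto_divide gauss_avg_tendsto[OF cont bnd] integrable_gauss1 tendsto_intros) auto

lemma heat2_joint: "jointly_continuous heat2"
  unfolding jointly_continuous_def heat2_def
  by (intro allI impI tendsto_divide gauss_avg_tendsto[OF cont bnd] integrable_gauss2 tendsto_intros) auto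

lemma heat_continuous_intro:
  assumes tends: "jointly_continuous heat"
    and R: "continuous_on A R" "continuous_on A \<tau>" "continuous_on A X" "\<And>a. a \<in> A \<Longrightarrow> R a > 0"
  shows "continuous_on (A :: 'b :: metric_space set) (\<lambda>a. heat (R a) (g (\<tau> a)) (X a))"
  unfolding continuous_on_sequentially comp_def
proof (intro allI ballI impI)
  fix s a assume a: "a \<in> A" and s: "(\<forall>n. s n \<in> A) \<and> s \<longlonglongrightarrow> a"
  have lim: "(\<lambda>n. F (s n)) \<longlonglongrightarrow> F a" if "continuous_on A F" for F :: "'b \<Rightarrow> real"
    using that a s by (intro continuous_on_tendsto_compose[of A F s a]) auto
  show "(\<lambda>n. heat (R (s n)) (g (\<tau> (s n))) (X (s n))) \<longlonglongrightarrow> heat (R a) (g (\<tau> a)) (X a)"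
    by (rule jointly_continuousD[OF tends lim[OF R(1)] lim[OF R(2)] lim[OF R(3)] R(4)[OF a]])
qed

lemma duhamel_integrand_measurable:
  assumes tends: "jointly_continuous heat"
  shows "(\<lambda>r. indicator {0<..<t} r * heat r (g (t - r)) x) \<in> borel_measurable lborel"
proof -
  have "(\<lambda>r. indicator {0<..<t} r *\<^sub>R heat r (g (t - r)) x) \<in> borel_measurable borel"
    by (intro borel_measurable_continuous_on_indicator heat_continuous_intro[OF tends])
      (auto intro!: continuous_intros)
  then show ?thesis by simp
qed

lemma duhamel_integrand_integrable:
  assumes tends: "jointly_continuous heat"
    and bound: "\<And>r x. 0 < r \<Longrightarrow> r < t \<Longrightarrow> \<bar>heat r (g (t - r)) x\<bar> \<le> C * r powr a" and a: "a > -1"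
  shows "integrable lborel (\<lambda>r. indicator {0<..<t} r * heat r (g (t - r)) x)"
proof (rule Bochner_Integration.integrable_bound)
  show "integrable lborel (\<lambda>r. C * (indicator {0<..<t} r * r powr a))"
    using a by (intro integrable_mult_right integrable_powr_from_0)
  show "(\<lambda>r. indicator {0<..<t} r * heat r (g (t - r)) x) \<in> borel_measurable lborel"
    by (rule duhamel_integrand_measurable[OF tends])
  show "AE r in lborel. norm (indicator {0<..<t} r * heat r (g (t - r)) x) \<le> norm (C * (indicator {0<..<t} r * r powr a))"
  proof (rule AE_I2)
    fix r
    show "norm (indicator {0<..<t} r * heat r (g (t - r)) x) \<le> norm (C * (indicator {0<..<t} r * r powr a))"
      using bound[of r x] by (auto simp: indicator_def)
  qed
qed

text \<open>The power on (0, T) dominates the integrands for all \<open>t n\<close> at once.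
  Pointwise convergence can fail only at \<open>r = t0\<close>, where the limiting indicator jumps,
  and this is a null set.\<close>

lemma duhamel_tendsto:
  assumes tends: "jointly_continuous heat"
    and bound: "\<And>r t x. 0 < r \<Longrightarrow> r < t \<Longrightarrow> t \<le> T \<Longrightarrow> \<bar>heat r (g (t - r)) x\<bar> \<le> C * r powr a" and a: "a > -1"
    and t: "t \<longlonglongrightarrow> t0" "\<And>n. t n \<le> T" and x: "x \<longlonglongrightarrow> x0"
  shows "(\<lambda>n. duhamel heat g (t n) (x n)) \<longlonglongrightarrow> duhamel heat g t0 x0"
  unfolding duhamel_def
proof (rule integral_dominated_convergence)
  show "(\<lambda>r. indicator {0<..<t0} r * heat r (g (t0 - r)) x0) \<in> borel_measurable lborel"
    by (rule duhamel_integrand_measurable[OF tends])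
  show "(\<lambda>r. indicator {0<..<t n} r * heat r (g (t n - r)) (x n)) \<in> borel_measurable lborel" for n
    by (rule duhamel_integrand_measurable[OF tends])
  show "integrable lborel (\<lambda>r. \<bar>C\<bar> * (indicator {0<..<T} r * r powr a))"
    using a by (intro integrable_mult_right integrable_powr_from_0)
  show "AE r in lborel. (\<lambda>n. indicator {0<..<t n} r * heat r (g (t n - r)) (x n)) \<longlonglongrightarrow> indicator {0<..<t0} r * heat r (g (t0 - r)) x0"
    using AE_lborel_singleton[of t0]
  proof eventually_elim
    case (elim r)
    show ?case
    proof (cases "r > 0")
      case True
      have "\<forall>\<^sub>F n in sequentially. indicator {0<..<t n} r = (indicator {0<..<t0} r :: real)"
      proof (cases "r < t0")
        case True
        then show ?thesis using order_tendstoD(1)[OF t(1), of r] \<open>r > 0\<close>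
          by (auto elim!: eventually_mono simp: indicator_def)
      next
        case False
        then show ?thesis using order_tendstoD(2)[OF t(1), of r] elim
          by (auto elim!: eventually_mono simp: indicator_def)
      qed
      then have "(\<lambda>n. indicator {0<..<t n} r :: real) \<longlonglongrightarrow> indicator {0<..<t0} r"
        by (rule tendsto_eventually)
      moreover have "(\<lambda>n. heat r (g (t n - r)) (x n)) \<longlonglongrightarrow> heat r (g (t0 - r)) x0"
        using True by (intro jointly_continuousD[OF tends] tendsto_intros t x)
      ultimately show ?thesis by (intro tendsto_intros)
    qed simp
  qed
  show "AE r in lborel. norm (indicator {0<..<t n} r * heat r (g (t n - r)) (x n)) \<le> \<bar>C\<bar> * (indicator {0<..<T} r * r powr a)" for n
  proof (rule AE_I2)
    fix r
    have "\<bar>heat r (g (t n - r)) (x n)\<bar> \<le> \<bar>C\<bar> * r powr a" if "0 < r" "r < t n"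
      using bound[OF that t(2), of "x n"] mult_right_mono[OF abs_ge_self[of C], of "r powr a"] by simp
    then show "norm (indicator {0<..<t n} r * heat r (g (t n - r)) (x n)) \<le> \<bar>C\<bar> * (indicator {0<..<T} r * r powr a)"
      using t(2)[of n] by (auto simp: indicator_def)
  qed
qed

lemma duhamel_continuous:
  assumes tends: "jointly_continuous heat"
    and bound: "\<And>r t x. 0 < r \<Longrightarrow> r < t \<Longrightarrow> t \<le> T \<Longrightarrow> \<bar>heat r (g (t - r)) x\<bar> \<le> C * r powr a" and a: "a > -1"
  shows "continuous_on ({..T} \<times> UNIV) (\<lambda>(t, x). duhamel heat g t x)"
  unfolding continuous_on_sequentially comp_def
proof (intro allI ballI impI)
  fix s p assume "p \<in> {..T} \<times> (UNIV :: real set)" and s: "(\<forall>n. s n \<in> {..T} \<times> UNIV) \<and> s \<longlonglongrightarrow> p"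
  have "(\<lambda>n. duhamel heat g (fst (s n)) (snd (s n))) \<longlonglongrightarrow> duhamel heat g (fst p) (snd p)"
    using s by (intro duhamel_tendsto[OF tends bound a] tendsto_intros) (auto simp: mem_Times_iff)
  then show "(\<lambda>n. case s n of (t, x) \<Rightarrow> duhamel heat g t x) \<longlonglongrightarrow> (case p of (t, x) \<Rightarrow> duhamel heat g t x)"
    by (simp add: case_prod_beta)
qed

text \<open>The formal power \<open>r powr 0\<close> puts the sup bound into the shape shared with
  the singular kernels.\<close>

lemma heat0_bound_powr: "\<bar>heat0 r (g s) x\<bar> \<le> M * r powr 0" if "r > 0"
  using heat0_bound[OF cont1 bnd, of r s x] that by simp

lemma heat1_bound_powr: "\<bar>heat1 r (g s) x\<bar> \<le> M * heat1_const * r powr (- 1 / 2)" if "r > 0"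
  using heat1_bound[OF cont1 bnd that] .

lemma duhamel0_continuous: "continuous_on ({..T} \<times> UNIV) (\<lambda>(t, x). duhamel heat0 g t x)"
  by (rule duhamel_continuous[OF heat0_joint, where a = 0 and C = M])
    (auto intro!: heat0_bound_powr simp del: powr_zero_eq_one)

lemma duhamel1_continuous: "continuous_on ({..T} \<times> UNIV) (\<lambda>(t, x). duhamel heat1 g t x)"
  by (rule duhamel_continuous[OF heat1_joint, where a = "- 1 / 2" and C = "M * heat1_const"])
    (auto intro!: heat1_bound_powr[simplified])

lemma duhamel0_deriv_x: "((\<lambda>x. duhamel heat0 g t x) has_real_derivative duhamel heat1 g t x) (at x)"
  unfolding duhamel_def
proof (rule has_real_derivative_integral_dominated[where e = 1
      and w = "\<lambda>r. M * heat1_const * (indicator {0<..<t} r * r powr (- 1 / 2))"])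
  show "integrable lborel (\<lambda>r. indicator {0<..<t} r * heat0 r (g (t - r)) y)" for y
    by (rule duhamel_integrand_integrable[OF heat0_joint, where a = 0 and C = M])
      (auto intro!: heat0_bound_powr simp del: powr_zero_eq_one)
  show "((\<lambda>y. indicator {0<..<t} r * heat0 r (g (t - r)) y) has_real_derivative
      indicator {0<..<t} r * heat1 r (g (t - r)) y) (at y)" for y r
    using heat0_deriv_x[OF cont1 bnd] by (cases "0 < r \<and> r < t") (auto simp: indicator_def)
  show "\<bar>indicator {0<..<t} r * heat1 r (g (t - r)) y\<bar> \<le> M * heat1_const * (indicator {0<..<t} r * r powr (- 1 / 2))" for y r
    using heat1_bound_powr[of r "t - r" y] by (auto simp: indicator_def)
  show "integrable lborel (\<lambda>r. M * heat1_const * (indicator {0<..<t} r * r powr (- 1 / 2)))"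
    by (intro integrable_mult_right integrable_powr_from_0) simp
  show "(\<lambda>r. indicator {0<..<t} r * heat1 r (g (t - r)) x) \<in> borel_measurable lborel"
    by (rule duhamel_integrand_measurable[OF heat1_joint])
qed simp

text \<open>At each age the semigroup preserves the bound \<open>b (t - r)\<close>, so only its
  integral remains. Passing an antiderivative \<open>B\<close> allows constant and exponential
  bounds to be handled alike.\<close>

lemma duhamel0_le:
  assumes b: "\<And>s x. 0 < s \<Longrightarrow> s < t \<Longrightarrow> \<bar>g s x\<bar> \<le> b s" and t: "t \<ge> 0"
    and B: "\<And>s. 0 \<le> s \<Longrightarrow> s \<le> t \<Longrightarrow> (B has_real_derivative b s) (at s)" and cb: "continuous_on {0..t} b"
  shows "\<bar>duhamel heat0 g t x\<bar> \<le> B t - B 0"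
proof -
  \<comment> \<open>Time runs backwards in \<open>r\<close>, hence the two minus signs.\<close>
  have "((\<lambda>r. - B (t - r)) has_vector_derivative b (t - r)) (at r within {0..t})" if "0 \<le> r" "r \<le> t" for r
  proof -
    have "((\<lambda>r. t - r) has_real_derivative - 1) (at r)" by (auto intro!: derivative_eq_intros)
    from DERIV_minus[OF DERIV_chain2[OF B this]] that
    have "((\<lambda>r. - B (t - r)) has_real_derivative b (t - r)) (at r)" by simp
    then show ?thesis
      unfolding has_real_derivative_iff_has_vector_derivative[symmetric] by (rule has_field_derivative_at_within)
  qed
  moreover have cb': "continuous_on {0..t} (\<lambda>r. b (t - r))"
    by (rule continuous_on_compose2[OF cb]) (auto intro!: continuous_intros)
  ultimately have I: "(\<integral>r. indicator {0..t} r *\<^sub>R b (t - r) \<partial>lborel) = B t - B 0"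
    using integral_FTC_atLeastAtMost[of 0 t "\<lambda>r. - B (t - r)" "\<lambda>r. b (t - r)"] t by simp
  have int: "integrable lborel (\<lambda>r. indicator {0<..<t} r * heat0 r (g (t - r)) x)"
    by (rule duhamel_integrand_integrable[OF heat0_joint, where a = 0 and C = M])
      (auto intro!: heat0_bound_powr simp del: powr_zero_eq_one)
  have "\<bar>duhamel heat0 g t x\<bar> \<le> (\<integral>r. \<bar>indicator {0<..<t} r * heat0 r (g (t - r)) x\<bar> \<partial>lborel)"
    unfolding duhamel_def using integral_norm_bound[of lborel "\<lambda>r. indicator {0<..<t} r * heat0 r (g (t - r)) x"] by simp
  also have "\<dots> \<le> (\<integral>r. indicator {0<..<t} r *\<^sub>R b (t - r) \<partial>lborel)"
  proof (rule integral_mono)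
    show "integrable lborel (\<lambda>r. \<bar>indicator {0<..<t} r * heat0 r (g (t - r)) x\<bar>)" using int by (rule integrable_abs)
    have "set_integrable lborel {0..t} (\<lambda>r. b (t - r))"
      by (rule borel_integrable_atLeastAtMost'[OF cb'])
    then have "set_integrable lborel {0<..<t} (\<lambda>r. b (t - r))"
      by (rule set_integrable_subset) auto
    then show "integrable lborel (\<lambda>r. indicator {0<..<t} r *\<^sub>R b (t - r))" by (simp add: set_integrable_def)
    show "\<bar>indicator {0<..<t} r * heat0 r (g (t - r)) x\<bar> \<le> indicator {0<..<t} r *\<^sub>R b (t - r)" for r
      using heat0_bound[OF cont1 b, of "t - r" r x] by (auto simp: indicator_def)
  qed
  also have "\<dots> = (\<integral>r. indicator {0..t} r *\<^sub>R b (t - r) \<partial>lborel)"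
  proof (rule integral_cong_AE)
    show "(\<lambda>r. indicator {0..t} r *\<^sub>R b (t - r)) \<in> borel_measurable lborel"
      using borel_measurable_continuous_on_indicator[OF _ cb'] by simp
    have "continuous_on {0<..<t} (\<lambda>r. b (t - r))" using cb' by (rule continuous_on_subset) auto
    then show "(\<lambda>r. indicator {0<..<t} r *\<^sub>R b (t - r)) \<in> borel_measurable lborel"
      using borel_measurable_continuous_on_indicator[of "{0<..<t}" "\<lambda>r. b (t - r)"] by simp
    show "AE r in lborel. indicator {0<..<t} r *\<^sub>R b (t - r) = indicator {0..t} r *\<^sub>R b (t - r)"
      using AE_lborel_singleton[of t] AE_lborel_singleton[of 0] by eventually_elim (auto simp: indicator_def)
  qed
  finally show ?thesis using I by simp
qed

text \<open>The space derivative is bounded by the integral of the \<open>heat1\<close> singularity;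
  enlarging its range to (0, T) makes the constant uniform in \<open>t\<close>.\<close>

lemma duhamel0_lipschitz:
  assumes "t \<le> T"
  shows "\<bar>duhamel heat0 g t x - duhamel heat0 g t y\<bar>
    \<le> M * heat1_const * (\<integral>r. indicator {0<..<T} r * r powr (- 1 / 2) \<partial>lborel) * \<bar>x - y\<bar>"
proof -
  define L where "L = M * heat1_const * (\<integral>r. indicator {0<..<T} r * r powr (- 1 / 2) \<partial>lborel)"
  have D: "\<bar>duhamel heat1 g t x\<bar> \<le> L" for x
  proof -
    have int: "integrable lborel (\<lambda>r. indicator {0<..<t} r * heat1 r (g (t - r)) x)"
      by (rule duhamel_integrand_integrable[OF heat1_joint, where a = "- 1 / 2" and C = "M * heat1_const"])
        (auto intro!: heat1_bound_powr[simplified])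
    have "\<bar>duhamel heat1 g t x\<bar> \<le> (\<integral>r. \<bar>indicator {0<..<t} r * heat1 r (g (t - r)) x\<bar> \<partial>lborel)"
      unfolding duhamel_def using integral_norm_bound[of lborel "\<lambda>r. indicator {0<..<t} r * heat1 r (g (t - r)) x"] by simp
    also have "\<dots> \<le> (\<integral>r. M * heat1_const * (indicator {0<..<T} r * r powr (- 1 / 2)) \<partial>lborel)"
    proof (rule integral_mono)
      show "integrable lborel (\<lambda>r. \<bar>indicator {0<..<t} r * heat1 r (g (t - r)) x\<bar>)" using int by (rule integrable_abs)
      show "integrable lborel (\<lambda>r. M * heat1_const * (indicator {0<..<T} r * r powr (- 1 / 2)))"
        by (intro integrable_mult_right integrable_powr_from_0) simp
      show "\<bar>indicator {0<..<t} r * heat1 r (g (t - r)) x\<bar> \<le> M * heat1_const * (indicator {0<..<T} r * r powr (- 1 / 2))" for r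
        using heat1_bound_powr[of r "t - r" x] assms M_nonneg heat_const_nonneg by (auto simp: indicator_def)
    qed
    finally show ?thesis by (simp add: L_def)
  qed
  have "norm (duhamel heat0 g t x - duhamel heat0 g t y) \<le> L * norm (x - y)"
    by (rule field_differentiable_bound[where S = UNIV and f' = "duhamel heat1 g t"])
      (auto intro: D duhamel0_deriv_x has_field_derivative_at_within)
  then show ?thesis by (simp add: L_def)
qed

end

lemma duhamel0_diff:
  assumes "bounded_source g M" and "bounded_source h N"
  shows "duhamel heat0 (\<lambda>t x. g t x - h t x) t x = duhamel heat0 g t x - duhamel heat0 h t x"
proof -
  interpret g: bounded_source g M by fact
  interpret h: bounded_source h N by fact
  have "integrable lborel (\<lambda>r. indicator {0<..<t} r * heat0 r (g (t - r)) x)"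
    by (rule g.duhamel_integrand_integrable[OF g.heat0_joint, where a = 0 and C = M])
      (auto intro!: g.heat0_bound_powr simp del: powr_zero_eq_one)
  moreover have "integrable lborel (\<lambda>r. indicator {0<..<t} r * heat0 r (h (t - r)) x)"
    by (rule h.duhamel_integrand_integrable[OF h.heat0_joint, where a = 0 and C = N])
      (auto intro!: h.heat0_bound_powr simp del: powr_zero_eq_one)
  ultimately show ?thesis
    unfolding duhamel_def heat0_diff[OF g.cont1 g.bnd h.cont1 h.bnd] right_diff_distrib
    by (rule Bochner_Integration.integral_diff)
qed

section \<open>Classical regularity for sources that are Hoelder continuous in space\<close>

locale hoelder_source = bounded_source +
  assumes hoelder: "\<And>T. \<exists>K. \<forall>t\<in>{0..T}. \<forall>x y. \<bar>g t x - g t y\<bar> \<le> K * sqrt \<bar>x - y\<bar>"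
begin

lemma heat2_bound_powr:
  obtains C where "C \<ge> 0"
    and "\<And>r t x. 0 < r \<Longrightarrow> r < t \<Longrightarrow> t \<le> T \<Longrightarrow> \<bar>heat2 r (g (t - r)) x\<bar> \<le> C * r powr (- 3 / 4)"
proof -
  obtain K where K: "\<And>t x y. t \<in> {0..T} \<Longrightarrow> \<bar>g t x - g t y\<bar> \<le> K * sqrt \<bar>x - y\<bar>"
    using hoelder by blast
  show ?thesis
  proof (rule that)
    show "\<bar>K\<bar> * heat2_const \<ge> 0" using heat_const_nonneg by simp
    fix r t x :: real assume r: "0 < r" "r < t" "t \<le> T"
    then have "\<bar>g (t - r) x - g (t - r) y\<bar> \<le> \<bar>K\<bar> * sqrt \<bar>x - y\<bar>" for x y
      using K[of "t - r" x y] mult_right_mono[OF abs_ge_self[of K], of "sqrt \<bar>x - y\<bar>"] by simp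
    then show "\<bar>heat2 r (g (t - r)) x\<bar> \<le> \<bar>K\<bar> * heat2_const * r powr (- 3 / 4)"
      using r by (intro heat2_bound[OF cont1 bnd]) auto
  qed
qed

lemma duhamel2_continuous: "continuous_on ({..T} \<times> UNIV) (\<lambda>(t, x). duhamel heat2 g t x)"
proof -
  obtain C where "C \<ge> 0" and *: "\<And>r t x. 0 < r \<Longrightarrow> r < t \<Longrightarrow> t \<le> T \<Longrightarrow> \<bar>heat2 r (g (t - r)) x\<bar> \<le> C * r powr (- 3 / 4)"
    using heat2_bound_powr by metis
  from * show ?thesis by (rule duhamel_continuous[OF heat2_joint]) auto
qed

lemma duhamel1_deriv_x: "((\<lambda>x. duhamel heat1 g t x) has_real_derivative duhamel heat2 g t x) (at x)"
proof -
  obtain C where "C \<ge> 0" and C: "\<And>r s x. 0 < r \<Longrightarrow> r < s \<Longrightarrow> s \<le> t \<Longrightarrow> \<bar>heat2 r (g (s - r)) x\<bar> \<le> C * r powr (- 3 / 4)"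
    using heat2_bound_powr by metis
  show ?thesis
    unfolding duhamel_def
  proof (rule has_real_derivative_integral_dominated[where e = 1
        and w = "\<lambda>r. C * (indicator {0<..<t} r * r powr (- 3 / 4))"])
    show "integrable lborel (\<lambda>r. indicator {0<..<t} r * heat1 r (g (t - r)) y)" for y
      by (rule duhamel_integrand_integrable[OF heat1_joint, where a = "- 1 / 2" and C = "M * heat1_const"])
        (auto intro!: heat1_bound_powr[simplified])
    show "((\<lambda>y. indicator {0<..<t} r * heat1 r (g (t - r)) y) has_real_derivative
        indicator {0<..<t} r * heat2 r (g (t - r)) y) (at y)" for y r
      using heat1_deriv_x[OF cont1 bnd] by (cases "0 < r \<and> r < t") (auto simp: indicator_def)
    show "\<bar>indicator {0<..<t} r * heat2 r (g (t - r)) y\<bar> \<le> C * (indicator {0<..<t} r * r powr (- 3 / 4))" for y r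
      using C[of r t y] by (auto simp: indicator_def)
    show "integrable lborel (\<lambda>r. C * (indicator {0<..<t} r * r powr (- 3 / 4)))"
      by (intro integrable_mult_right integrable_powr_from_0) simp
    show "(\<lambda>r. indicator {0<..<t} r * heat2 r (g (t - r)) x) \<in> borel_measurable lborel"
      by (rule duhamel_integrand_measurable[OF heat2_joint])
  qed simp
qed

text \<open>Exchanging the integrals turns the inner one into
  \<open>\<integral>\<^sub>\<sigma>\<^sup>t heat2 (\<tau> - \<sigma>) (g \<sigma>) x d\<tau> = heat0 (t - \<sigma>) (g \<sigma>) x - g \<sigma> x\<close>.\<close>

lemma integral_duhamel2:
  assumes t: "t > 0"
  shows "(\<integral>\<tau>. indicator {0<..<t} \<tau> * duhamel heat2 g \<tau> x \<partial>lborel)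
    = duhamel heat0 g t x - (\<integral>\<tau>. indicator {0<..<t} \<tau> * g \<tau> x \<partial>lborel)"
proof -
  obtain C where C: "C \<ge> 0"
    "\<And>r s x. 0 < r \<Longrightarrow> r < s \<Longrightarrow> s \<le> t \<Longrightarrow> \<bar>heat2 r (g (s - r)) x\<bar> \<le> C * r powr (- 3 / 4)"
    using heat2_bound_powr by metis
  \<comment> \<open>Pairs of emission time \<sigma> and observation time \<tau>. Strict inequalities
    keep the kernel away from its singularity, so the integrand is continuous on this open triangle
    and therefore Borel.\<close>
  define S where "S = {p :: real \<times> real. 0 < fst p \<and> fst p < snd p \<and> snd p < t}"
  define F where "F = (\<lambda>\<sigma> \<tau>. indicator S (\<sigma>, \<tau>) * heat2 (\<tau> - \<sigma>) (g \<sigma>) x)"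
  define w where "w = (\<lambda>r. C * (indicator {0<..<t} r * r powr (- 3 / 4)))"
  have w: "integrable lborel w"
    unfolding w_def by (intro integrable_mult_right integrable_powr_from_0) simp
  have w0: "w r \<ge> 0" for r using C(1) by (simp add: w_def)
  have S: "open S"
    unfolding S_def by (intro open_Collect_conj open_Collect_less continuous_intros)
  have "(\<lambda>p. indicator S p *\<^sub>R heat2 (snd p - fst p) (g (fst p)) x) \<in> borel_measurable borel"
    using S by (intro borel_measurable_continuous_on_indicator heat_continuous_intro[OF heat2_joint] continuous_intros)
      (auto simp: S_def)
  moreover have "case_prod F = (\<lambda>p. indicator S p *\<^sub>R heat2 (snd p - fst p) (g (fst p)) x)"
    by (auto simp: F_def)
  ultimately have meas[measurable]: "case_prod F \<in> borel_measurable (lborel \<Otimes>\<^sub>M lborel)"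
    by (simp add: lborel_prod)
  \<comment> \<open>The majorant is a translate of the fixed function \<open>w\<close>, so its
    \<tau>-integral does not depend on \<sigma>; this yields absolute integrability over the
    triangle. The form \<open>- \<sigma> + 1 * \<tau>\<close> matches the affine substitution
    rule.\<close>
  have F_bound: "\<bar>F \<sigma> \<tau>\<bar> \<le> indicator {0<..<t} \<sigma> * w (- \<sigma> + 1 * \<tau>)" for \<sigma> \<tau>
    using C(2)[of "\<tau> - \<sigma>" \<tau> x] C(1) by (auto simp: F_def w_def S_def indicator_def intro!: mult_nonneg_nonneg)
  have w_shift: "integrable lborel (\<lambda>\<tau>. w (- \<sigma> + 1 * \<tau>))" for \<sigma>
    using w by (rule lborel_integrable_real_affine) simp
  have int_w_shift: "(\<integral>\<tau>. w (- \<sigma> + 1 * \<tau>) \<partial>lborel) = (\<integral>r. w r \<partial>lborel)" for \<sigma>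
    using lborel_integral_real_affine[of 1 w "- \<sigma>"] by simp
  have int2: "integrable lborel (F \<sigma>)" for \<sigma>
  proof (rule Bochner_Integration.integrable_bound)
    show "integrable lborel (\<lambda>\<tau>. indicator {0<..<t} \<sigma> * w (- \<sigma> + 1 * \<tau>))"
      by (intro integrable_mult_right w_shift)
    show "F \<sigma> \<in> borel_measurable lborel"
      using measurable_compose[OF measurable_Pair1'[of \<sigma> lborel lborel] meas] by simp
    show "AE \<tau> in lborel. norm (F \<sigma> \<tau>) \<le> norm (indicator {0<..<t} \<sigma> * w (- \<sigma> + 1 * \<tau>))"
      using F_bound[of \<sigma>] w0 by (intro AE_I2) (simp add: abs_mult)
  qed
  have int: "integrable (lborel \<Otimes>\<^sub>M lborel) (case_prod F)"
  proof (rule lborel_pair.Fubini_integrable)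
    show "integrable lborel (\<lambda>\<sigma>. \<integral>\<tau>. norm (case_prod F (\<sigma>, \<tau>)) \<partial>lborel)"
    proof (rule Bochner_Integration.integrable_bound)
      show "integrable lborel (\<lambda>\<sigma>. indicator {0<..<t} \<sigma> * (\<integral>r. w r \<partial>lborel))"
        using t by (intro integrable_mult_left integrable_real_indicator) auto
      show "(\<lambda>\<sigma>. \<integral>\<tau>. norm (case_prod F (\<sigma>, \<tau>)) \<partial>lborel) \<in> borel_measurable lborel"
        by measurable
      show "AE \<sigma> in lborel. norm (\<integral>\<tau>. norm (case_prod F (\<sigma>, \<tau>)) \<partial>lborel) \<le> norm (indicator {0<..<t} \<sigma> * (\<integral>r. w r \<partial>lborel))"
      proof (rule AE_I2)
        fix \<sigma>
        have "(\<integral>\<tau>. \<bar>F \<sigma> \<tau>\<bar> \<partial>lborel) \<le> (\<integral>\<tau>. indicator {0<..<t} \<sigma> * w (- \<sigma> + 1 * \<tau>) \<partial>lborel)"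
          using F_bound by (intro integral_mono integrable_abs int2 integrable_mult_right w_shift)
        also have "\<dots> = indicator {0<..<t} \<sigma> * (\<integral>r. w r \<partial>lborel)"
          using int_w_shift[of \<sigma>] by simp
        finally show "norm (\<integral>\<tau>. norm (case_prod F (\<sigma>, \<tau>)) \<partial>lborel) \<le> norm (indicator {0<..<t} \<sigma> * (\<integral>r. w r \<partial>lborel))"
          by (simp add: abs_of_nonneg)
      qed
    qed
    show "AE \<sigma> in lborel. integrable lborel (\<lambda>\<tau>. case_prod F (\<sigma>, \<tau>))" using int2 by simp
  qed measurable
  have outer: "(\<integral>\<sigma>. F \<sigma> \<tau> \<partial>lborel) = indicator {0<..<t} \<tau> * duhamel heat2 g \<tau> x" for \<tau>
  proof -
    have "(\<integral>\<sigma>. F \<sigma> \<tau> \<partial>lborel) = (\<integral>r. F (\<tau> + (- 1) * r) \<tau> \<partial>lborel)"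
      using lborel_integral_real_affine[of "- 1" "\<lambda>\<sigma>. F \<sigma> \<tau>" \<tau>] by simp
    also have "\<dots> = (\<integral>r. indicator {0<..<t} \<tau> * (indicator {0<..<\<tau>} r * heat2 r (g (\<tau> - r)) x) \<partial>lborel)"
      by (intro Bochner_Integration.integral_cong) (auto simp: F_def S_def indicator_def)
    finally show ?thesis by (simp add: duhamel_def)
  qed
  have inner: "(\<integral>\<tau>. F \<sigma> \<tau> \<partial>lborel) = indicator {0<..<t} \<sigma> * (heat0 (t - \<sigma>) (g \<sigma>) x - g \<sigma> x)" for \<sigma>
  proof (cases "0 < \<sigma> \<and> \<sigma> < t")
    case True
    have F_eq: "F \<sigma> = (\<lambda>\<tau>. indicator {\<sigma><..<t} \<tau> *\<^sub>R heat2 (\<tau> - \<sigma>) (g \<sigma>) x)"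
      using True by (auto simp: F_def S_def indicator_def)
    have "set_integrable lborel {\<sigma><..<t} (\<lambda>\<tau>. heat2 (\<tau> - \<sigma>) (g \<sigma>) x)"
      using int2[of \<sigma>] unfolding F_eq set_integrable_def .
    from set_borel_integral_eq_integral(2)[OF this]
    have "(\<integral>\<tau>. F \<sigma> \<tau> \<partial>lborel) = integral {\<sigma><..<t} (\<lambda>\<tau>. heat2 (\<tau> - \<sigma>) (g \<sigma>) x)"
      unfolding F_eq set_lebesgue_integral_def .
    also have "\<dots> = integral {\<sigma>..t} (\<lambda>\<tau>. heat2 (\<tau> - \<sigma>) (g \<sigma>) x)" by (rule integral_open_interval_real[symmetric])
    also have "\<dots> = heat0 (t - \<sigma>) (g \<sigma>) x - heat0 (\<sigma> - \<sigma>) (g \<sigma>) x"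
    \<comment> \<open>The derivative \<open>heat2\<close> may be singular at \<tau> = \<sigma>, but
      \<open>heat0\<close> is continuous up to that endpoint, so the interior form of the
      fundamental theorem suffices.\<close>
    proof (intro integral_unique fundamental_theorem_of_calculus_interior)
      show "continuous_on {\<sigma>..t} (\<lambda>\<tau>. heat0 (\<tau> - \<sigma>) (g \<sigma>) x)"
        unfolding continuous_on_sequentially comp_def
        by (auto intro!: heat0_tendsto tendsto_intros)
      show "((\<lambda>\<tau>. heat0 (\<tau> - \<sigma>) (g \<sigma>) x) has_vector_derivative heat2 (\<tau> - \<sigma>) (g \<sigma>) x) (at \<tau>)" if "\<tau> \<in> {\<sigma><..<t}" for \<tau>
      proof -
        have "((\<lambda>\<tau>. \<tau> - \<sigma>) has_real_derivative 1) (at \<tau>)" by (auto intro!: derivative_eq_intros)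
        from DERIV_chain2[OF heat0_deriv_time[OF cont1 bnd] this] that show ?thesis
          unfolding has_real_derivative_iff_has_vector_derivative[symmetric] by simp
      qed
    qed (use True in auto)
    finally show ?thesis using True by simp
  next
    case False
    then have "F \<sigma> = (\<lambda>_. 0)" by (auto simp: F_def S_def indicator_def)
    with False show ?thesis by (auto simp: indicator_def)
  qed
  have int_g: "integrable lborel (\<lambda>\<sigma>. indicator {0<..<t} \<sigma> * g \<sigma> x)"
  proof -
    have "continuous_on {0..t} (\<lambda>\<sigma>. g \<sigma> x)"
      using continuous_on_compose2[OF cont, of "{0..t}" "\<lambda>\<sigma>. (\<sigma>, x)"] by (simp add: continuous_on_Pair)
    then have "set_integrable lborel {0<..<t} (\<lambda>\<sigma>. g \<sigma> x)"
      by (intro set_integrable_subset[OF borel_integrable_atLeastAtMost']) auto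
    then show ?thesis by (simp add: set_integrable_def)
  qed
  have int_h: "integrable lborel (\<lambda>r. indicator {0<..<t} r * heat0 r (g (t - r)) x)"
    by (rule duhamel_integrand_integrable[OF heat0_joint, where a = 0 and C = M])
      (auto intro!: heat0_bound_powr simp del: powr_zero_eq_one)
  \<comment> \<open>Reversing time turns the integral over emission times into the integral over
    ages that defines \<open>duhamel\<close>.\<close>
  define h where "h = (\<lambda>\<sigma>. indicator {0<..<t} \<sigma> * heat0 (t - \<sigma>) (g \<sigma>) x)"
  have h_eq: "(\<lambda>r. h (t + (- 1) * r)) = (\<lambda>r. indicator {0<..<t} r * heat0 r (g (t - r)) x)"
    by (auto simp: h_def indicator_def)
  have "(\<integral>\<tau>. indicator {0<..<t} \<tau> * duhamel heat2 g \<tau> x \<partial>lborel) = (\<integral>\<tau>. (\<integral>\<sigma>. F \<sigma> \<tau> \<partial>lborel) \<partial>lborel)"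
    by (simp add: outer)
  also have "\<dots> = (\<integral>\<sigma>. (\<integral>\<tau>. F \<sigma> \<tau> \<partial>lborel) \<partial>lborel)"
    by (rule lborel_pair.Fubini_integral[OF int])
  also have "\<dots> = (\<integral>\<sigma>. h \<sigma> - indicator {0<..<t} \<sigma> * g \<sigma> x \<partial>lborel)"
    by (simp add: inner h_def right_diff_distrib)
  also have "\<dots> = (\<integral>\<sigma>. h \<sigma> \<partial>lborel) - (\<integral>\<tau>. indicator {0<..<t} \<tau> * g \<tau> x \<partial>lborel)"
  proof (rule Bochner_Integration.integral_diff[OF _ int_g])
    show "integrable lborel h"
      using int_h lborel_integrable_real_affine_iff[of "- 1" h t] unfolding h_eq by simp
  qed
  also have "(\<integral>\<sigma>. h \<sigma> \<partial>lborel) = duhamel heat0 g t x"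
    using lborel_integral_real_affine[of "- 1" h t] unfolding h_eq duhamel_def by simp
  finally show ?thesis .
qed

lemma duhamel_source_continuous: "continuous_on {0..T} (\<lambda>\<tau>. duhamel heat2 g \<tau> x + g \<tau> x)"
proof -
  have "continuous_on {0..T} (\<lambda>\<tau>. g \<tau> x)"
    using continuous_on_compose2[OF cont, of "{0..T}" "\<lambda>\<sigma>. (\<sigma>, x)"] by (simp add: continuous_on_Pair)
  moreover have "continuous_on {0..T} (\<lambda>\<tau>. duhamel heat2 g \<tau> x)"
  proof -
    have "continuous_on {0..T} (\<lambda>\<tau>. (\<lambda>(t, x). duhamel heat2 g t x) (\<tau>, x))"
      by (rule continuous_on_compose2[OF duhamel2_continuous[of T]]) (auto intro!: continuous_intros)
    then show ?thesis by simp
  qed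
  ultimately show ?thesis by (intro continuous_intros)
qed

text \<open>Rearranging the Fubini identity exhibits the Duhamel term as the time integral of a
  continuous function, which makes it differentiable although the source is only continuous in
  time.\<close>

lemma duhamel0_eq_integral:
  assumes t: "t \<ge> 0"
  shows "duhamel heat0 g t x = integral {0..t} (\<lambda>\<tau>. duhamel heat2 g \<tau> x + g \<tau> x)"
proof (cases "t = 0")
  case True
  then show ?thesis by (simp add: duhamel_def)
next
  case False
  have c: "continuous_on {0..t} (\<lambda>\<tau>. g \<tau> x)"
    using continuous_on_compose2[OF cont, of "{0..t}" "\<lambda>\<sigma>. (\<sigma>, x)"] by (simp add: continuous_on_Pair)
  have set_int: "set_integrable lborel {0<..<t} f" if "continuous_on {0..t} f" for f :: "real \<Rightarrow> real"
    using that by (intro set_integrable_subset[OF borel_integrable_atLeastAtMost']) auto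
  note int_sum = set_int[OF duhamel_source_continuous[of t x]]
  have "integral {0..t} (\<lambda>\<tau>. duhamel heat2 g \<tau> x + g \<tau> x)
      = (\<integral>\<tau>. indicator {0<..<t} \<tau> * (duhamel heat2 g \<tau> x + g \<tau> x) \<partial>lborel)"
    using set_borel_integral_eq_integral(2)[OF int_sum]
    by (simp add: set_lebesgue_integral_def integral_open_interval_real)
  also have "\<dots> = (\<integral>\<tau>. indicator {0<..<t} \<tau> * duhamel heat2 g \<tau> x \<partial>lborel) + (\<integral>\<tau>. indicator {0<..<t} \<tau> * g \<tau> x \<partial>lborel)"
  proof -
    have g: "integrable lborel (\<lambda>\<tau>. indicator {0<..<t} \<tau> * g \<tau> x)"
      using set_int[OF c] by (simp add: set_integrable_def)
    have "integrable lborel (\<lambda>\<tau>. indicator {0<..<t} \<tau> * (duhamel heat2 g \<tau> x + g \<tau> x))"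
      using int_sum by (simp add: set_integrable_def)
    from Bochner_Integration.integrable_diff[OF this g]
    have "integrable lborel (\<lambda>\<tau>. indicator {0<..<t} \<tau> * duhamel heat2 g \<tau> x)" by (simp add: algebra_simps)
    from Bochner_Integration.integral_add[OF this g] show ?thesis by (simp add: algebra_simps)
  qed
  finally show ?thesis using integral_duhamel2[of t x] t False by simp
qed

lemma duhamel0_deriv_time:
  assumes t: "t > 0"
  shows "((\<lambda>t. duhamel heat0 g t x) has_real_derivative duhamel heat2 g t x + g t x) (at t)"
proof -
  \<comment> \<open>The interval extends past \<open>t\<close> so that \<open>t\<close> is interior
    and the derivative is two-sided.\<close>
  have "((\<lambda>t. integral {0..t} (\<lambda>\<tau>. duhamel heat2 g \<tau> x + g \<tau> x)) has_real_derivative duhamel heat2 g t x + g t x)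
      (at t within {0..t + 1})"
    using t by (intro integral_has_real_derivative duhamel_source_continuous) auto
  then have 1: "((\<lambda>t. integral {0..t} (\<lambda>\<tau>. duhamel heat2 g \<tau> x + g \<tau> x)) has_real_derivative duhamel heat2 g t x + g t x)
      (at t)"
    using t by (simp only: at_within_Icc_at)
  have ev: "\<forall>\<^sub>F t in nhds t. integral {0..t} (\<lambda>\<tau>. duhamel heat2 g \<tau> x + g \<tau> x) = duhamel heat0 g t x"
    using eventually_nhds_in_open[of "{0<..}" t] t by (auto elim!: eventually_mono simp: duhamel0_eq_integral)
  show ?thesis using 1 by (rule DERIV_cong_ev[OF refl ev refl, THEN iffD1])
qed

end

section \<open>Mild formulation of the inhomogeneous heat equation\<close>

definition mild :: "(real \<Rightarrow> real) \<Rightarrow> (real \<Rightarrow> real \<Rightarrow> real) \<Rightarrow> real \<Rightarrow> real \<Rightarrow> real" where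
  "mild f g t x = heat0 t f x + duhamel heat0 g t x"

definition mild_x :: "(real \<Rightarrow> real) \<Rightarrow> (real \<Rightarrow> real \<Rightarrow> real) \<Rightarrow> real \<Rightarrow> real \<Rightarrow> real" where
  "mild_x f g t x = heat1 t f x + duhamel heat1 g t x"

definition mild_xx :: "(real \<Rightarrow> real) \<Rightarrow> (real \<Rightarrow> real \<Rightarrow> real) \<Rightarrow> real \<Rightarrow> real \<Rightarrow> real" where
  "mild_xx f g t x = heat2 t f x + duhamel heat2 g t x"

text \<open>Viewing initial data as a time-independent source lets the continuity results for
  sources cover the semigroup term as well.\<close>

lemma bounded_source_const:
  assumes "continuous_on UNIV f" "\<And>x. \<bar>f x\<bar> \<le> N"
  shows "bounded_source (\<lambda>_. f) N"
proof
  show "continuous_on UNIV (\<lambda>(t :: real, x). f x)"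
    unfolding case_prod_beta using assms(1) by (rule continuous_on_compose2) (auto intro!: continuous_intros)
qed (use assms in auto)

text \<open>Sources are defined for all real times, so negative ones are included. There the Duhamel
  term is 0, and \<open>heat0\<close> remains meaningful because \<open>sqrt\<close> extends to
  negative arguments as an odd function; no case split at \<open>t = 0\<close> is required.\<close>

lemma mild_continuous:
  assumes f: "continuous_on UNIV f" "\<And>x. \<bar>f x\<bar> \<le> N" and g: "bounded_source g M"
  shows "continuous_on ({..T} \<times> UNIV) (\<lambda>(t, x). mild f g t x)"
proof -
  interpret f: bounded_source "\<lambda>_. f" N using f by (rule bounded_source_const)
  interpret g: bounded_source g M by fact
  have "continuous_on ({..T} \<times> UNIV) (\<lambda>p. heat0 (fst p) f (snd p))"
    unfolding continuous_on_sequentially comp_def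
    by (intro allI ballI impI f.heat0_tendsto tendsto_const tendsto_intros) auto
  from continuous_on_add[OF this g.duhamel0_continuous[of T, unfolded case_prod_beta]]
  show ?thesis unfolding mild_def case_prod_beta .
qed

lemma mild_derivs:
  assumes f: "continuous_on UNIV f" "\<And>x. \<bar>f x\<bar> \<le> N" and g: "hoelder_source g M"
  shows "t > 0 \<Longrightarrow> ((\<lambda>t. mild f g t x) has_real_derivative mild_xx f g t x + g t x) (at t)"
    and "t > 0 \<Longrightarrow> ((\<lambda>x. mild f g t x) has_real_derivative mild_x f g t x) (at x)"
    and "t > 0 \<Longrightarrow> ((\<lambda>x. mild_x f g t x) has_real_derivative mild_xx f g t x) (at x)"
    and "continuous_on ({0<..T} \<times> UNIV) (\<lambda>(t, x). mild_x f g t x)"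
    and "continuous_on ({0<..T} \<times> UNIV) (\<lambda>(t, x). mild_xx f g t x)"
proof -
  interpret f: bounded_source "\<lambda>_. f" N using f by (rule bounded_source_const)
  interpret g: hoelder_source g M by fact
  show "((\<lambda>t. mild f g t x) has_real_derivative mild_xx f g t x + g t x) (at t)" if "t > 0"
    unfolding mild_def mild_xx_def add.assoc
    by (intro DERIV_add heat0_deriv_time[OF f that] g.duhamel0_deriv_time[OF that])
  show "((\<lambda>x. mild f g t x) has_real_derivative mild_x f g t x) (at x)" if "t > 0"
    unfolding mild_def mild_x_def by (intro DERIV_add heat0_deriv_x[OF f that] g.duhamel0_deriv_x)
  show "((\<lambda>x. mild_x f g t x) has_real_derivative mild_xx f g t x) (at x)" if "t > 0"
    unfolding mild_x_def mild_xx_def by (intro DERIV_add heat1_deriv_x[OF f that] g.duhamel1_deriv_x)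
  have sub: "{0<..T} \<times> UNIV \<subseteq> {..T} \<times> (UNIV :: real set)" by auto
  have "continuous_on ({0<..T} \<times> UNIV) (\<lambda>p. heat1 (fst p) ((\<lambda>_. f) 0) (snd p))"
    by (rule f.heat_continuous_intro[OF f.heat1_joint]) (auto intro!: continuous_intros)
  from continuous_on_add[OF this continuous_on_subset[OF g.duhamel1_continuous[of T, unfolded case_prod_beta] sub]]
  show "continuous_on ({0<..T} \<times> UNIV) (\<lambda>(t, x). mild_x f g t x)"
    unfolding mild_x_def case_prod_beta .
  have "continuous_on ({0<..T} \<times> UNIV) (\<lambda>p. heat2 (fst p) ((\<lambda>_. f) 0) (snd p))"
    by (rule f.heat_continuous_intro[OF f.heat2_joint]) (auto intro!: continuous_intros)
  from continuous_on_add[OF this continuous_on_subset[OF g.duhamel2_continuous[of T, unfolded case_prod_beta] sub]]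
  show "continuous_on ({0<..T} \<times> UNIV) (\<lambda>(t, x). mild_xx f g t x)"
    unfolding mild_xx_def case_prod_beta .
qed

section \<open>Existence\<close>

text \<open>Clamping extends \<open>- z * ln z\<close> from \<open>[0, 1/e]\<close> to all reals (with \<open>ln 0 = 0\<close> giving the value
  \<open>0\<close> at \<open>0\<close>).\<close>

definition clamp_inv_e :: "real \<Rightarrow> real" where "clamp_inv_e z = max 0 (min z (exp (- 1)))"

definition entropy :: "real \<Rightarrow> real" where "entropy z = - (clamp_inv_e z * ln (clamp_inv_e z))"

lemma clamp_inv_e_bounds: "0 \<le> clamp_inv_e z" "clamp_inv_e z \<le> exp (- 1)"
  by (auto simp: clamp_inv_e_def)

lemma clamp_inv_e_mono: "a \<le> b \<Longrightarrow> clamp_inv_e a \<le> clamp_inv_e b"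
  by (auto simp: clamp_inv_e_def)

lemma clamp_inv_e_lipschitz: "\<bar>clamp_inv_e a - clamp_inv_e b\<bar> \<le> \<bar>a - b\<bar>"
  by (auto simp: clamp_inv_e_def)

text \<open>The tangent slope \<open>ln b + 1\<close> is nonpositive up to 1/e, whence monotonicity.
  The second bound drops the nonpositive term \<open>a * (ln a - ln b)\<close>; the third turns its
  logarithm into a square root.\<close>

lemma mult_ln_diff_bounds:
  fixes a b :: real
  assumes "0 \<le> a" "a < b" "b \<le> exp (- 1)"
  shows "b * ln b \<le> a * ln a" and "a * ln a - b * ln b \<le> (b - a) * (- ln b)"
    and "a * ln a - b * ln b \<le> 2 * sqrt (b - a)"
proof -
  have lnb: "ln b \<le> - 1" using assms by (metis ln_exp ln_le_cancel_iff exp_gt_zero order.strict_trans1)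
  show "b * ln b \<le> a * ln a"
  proof (cases "a = 0")
    case True
    have "b * ln b \<le> 0" using lnb assms by (intro mult_nonneg_nonpos) linarith+
    then show ?thesis using True by simp
  next
    case False
    then have "b * ln b - a * ln a \<le> (b - a) * (ln b + 1)" using assms by (intro mult_ln_diff_le) auto
    also have "\<dots> \<le> 0" using lnb assms by (intro mult_nonneg_nonpos) auto
    finally show ?thesis by simp
  qed
  have "a * (ln a - ln b) \<le> 0"
    using assms by (cases "a = 0") (auto intro!: mult_nonneg_nonpos)
  then show 1: "a * ln a - b * ln b \<le> (b - a) * (- ln b)" by (simp add: algebra_simps)
  define s where "s = sqrt (b - a)"
  have s: "s > 0" "b - a = s\<^sup>2" using assms by (auto simp: s_def)
  \<comment> \<open>Since \<open>b - a\<close> is at most \<open>b\<close>, the logarithm can be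
    measured in the increment itself: with s = sqrt (b - a) it is at most 2/s, while the prefactor
    is s^2.\<close>
  have "- ln b \<le> - ln (b - a)" using assms by simp
  also have "\<dots> = 2 * ln (1 / s)" using s by (simp add: ln_realpow ln_div)
  also have "\<dots> \<le> 2 * (1 / s - 1)" using s ln_le_minus_one[of "1 / s"] by simp
  also have "\<dots> \<le> 2 / s" by simp
  finally have "(b - a) * (- ln b) \<le> s\<^sup>2 * (2 / s)" by (intro mult_mono) (use assms lnb s in linarith)+
  also have "\<dots> = 2 * s" using s by (simp add: power2_eq_square)
  finally show "a * ln a - b * ln b \<le> 2 * sqrt (b - a)" using 1 by (simp add: s_def)
qed

lemma entropy_mono: "a \<le> b \<Longrightarrow> entropy a \<le> entropy b"
  using mult_ln_diff_bounds(1)[of "clamp_inv_e a" "clamp_inv_e b"] clamp_inv_e_mono[of a b] clamp_inv_e_bounds[of a] clamp_inv_e_bounds[of b]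
  unfolding entropy_def by (cases "clamp_inv_e a = clamp_inv_e b") auto

lemma entropy_nonpos_arg: "z \<le> 0 \<Longrightarrow> entropy z = 0"
  by (simp add: entropy_def clamp_inv_e_def)

lemma entropy_nonneg: "entropy z \<ge> 0"
  using entropy_mono[of "min z 0" z] entropy_nonpos_arg[of "min z 0"] by simp

lemma entropy_hoelder: "\<bar>entropy a - entropy b\<bar> \<le> 2 * sqrt \<bar>a - b\<bar>"
proof -
  have wlog: "\<bar>entropy a - entropy b\<bar> \<le> 2 * sqrt \<bar>a - b\<bar>" if "a \<le> b" for a b
  proof (cases "clamp_inv_e a = clamp_inv_e b")
    case False
    then have "clamp_inv_e a < clamp_inv_e b" using clamp_inv_e_mono[OF that] by simp
    then have "entropy b - entropy a \<le> 2 * sqrt (clamp_inv_e b - clamp_inv_e a)"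
      using mult_ln_diff_bounds(3)[of "clamp_inv_e a" "clamp_inv_e b"] clamp_inv_e_bounds[of a] clamp_inv_e_bounds[of b]
      by (simp add: entropy_def)
    moreover have "sqrt (clamp_inv_e b - clamp_inv_e a) \<le> sqrt \<bar>a - b\<bar>"
      using clamp_inv_e_lipschitz[of a b] by (intro real_sqrt_le_mono) linarith
    ultimately show ?thesis using entropy_mono[OF that] by linarith
  qed (simp add: entropy_def)
  show ?thesis using wlog[of a b] wlog[of b a] by (cases "a \<le> b") (auto simp: abs_minus_commute)
qed

text \<open>A crude bound, from the Hoelder estimate against the zero at 0.\<close>

lemma entropy_le_2: "entropy z \<le> 2"
proof -
  have "clamp_inv_e z \<le> 1" using clamp_inv_e_bounds(2)[of z] exp_le_one_iff[of "- 1"] by linarith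
  then have "sqrt \<bar>clamp_inv_e z - 0\<bar> \<le> 1" using clamp_inv_e_bounds(1)[of z] by simp
  moreover have "entropy (clamp_inv_e z) = entropy z"
    using clamp_inv_e_bounds[of z] by (simp add: entropy_def clamp_inv_e_def)
  ultimately show ?thesis using entropy_hoelder[of "clamp_inv_e z" 0] entropy_nonpos_arg[of 0] by linarith
qed

text \<open>The \<open>max\<close> flattens the profile near 0, where its slope is unbounded,
  without destroying monotonicity. For positive \<epsilon> the reaction stays positive at
  \<open>z = 0\<close>, so truncated solutions are not expected to remain nonnegative; the
  definition therefore covers all real \<open>z\<close>.\<close>

definition reaction :: "real \<Rightarrow> real \<Rightarrow> real \<Rightarrow> real" where
  "reaction lam \<epsilon> z = 2 * lam * entropy (max \<epsilon> z)"

context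
  fixes lam :: real
  assumes lam: "lam > 0"
begin

lemma reaction_mono: "a \<le> b \<Longrightarrow> reaction lam \<epsilon> a \<le> reaction lam \<epsilon> b"
  unfolding reaction_def using lam by (intro mult_left_mono entropy_mono) auto

lemma reaction_nonneg: "reaction lam \<epsilon> z \<ge> 0"
  unfolding reaction_def using lam entropy_nonneg by simp

lemma reaction_bound: "\<bar>- reaction lam \<epsilon> z\<bar> \<le> 4 * lam"
  using reaction_nonneg[of \<epsilon> z] entropy_le_2[of "max \<epsilon> z"] lam by (simp add: reaction_def)

lemma reaction_hoelder: "\<bar>reaction lam \<epsilon> a - reaction lam \<epsilon> b\<bar> \<le> 4 * lam * sqrt \<bar>a - b\<bar>"
proof -
  have "\<bar>entropy (max \<epsilon> a) - entropy (max \<epsilon> b)\<bar> \<le> 2 * sqrt \<bar>max \<epsilon> a - max \<epsilon> b\<bar>" by (rule entropy_hoelder)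
  also have "\<dots> \<le> 2 * sqrt \<bar>a - b\<bar>" by (intro mult_left_mono real_sqrt_le_mono) auto
  finally have "2 * lam * \<bar>entropy (max \<epsilon> a) - entropy (max \<epsilon> b)\<bar> \<le> 2 * lam * (2 * sqrt \<bar>a - b\<bar>)"
    using lam by (intro mult_left_mono) auto
  moreover have "\<bar>reaction lam \<epsilon> a - reaction lam \<epsilon> b\<bar> = 2 * lam * \<bar>entropy (max \<epsilon> a) - entropy (max \<epsilon> b)\<bar>"
    unfolding reaction_def using lam by (simp add: abs_mult flip: right_diff_distrib)
  ultimately show ?thesis by simp
qed

text \<open>Truncation moves the nonnegative part of \<open>z\<close> by at most \<epsilon>, and the
  Hoelder bound converts this into its square root. This is the vanishing error that enters the
  comparison of truncated solutions.\<close>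

lemma reaction_approx:
  assumes "\<epsilon> \<ge> 0"
  shows "\<bar>reaction lam \<epsilon> z - reaction lam 0 z\<bar> \<le> 4 * lam * sqrt \<epsilon>"
proof -
  have "reaction lam \<epsilon> z = reaction lam 0 (max \<epsilon> z)"
    using assms unfolding reaction_def by (simp add: max.absorb2 max.coboundedI1)
  moreover have "reaction lam 0 z = reaction lam 0 (max 0 z)"
    unfolding reaction_def by simp
  moreover have "sqrt \<bar>max \<epsilon> z - max 0 z\<bar> \<le> sqrt \<epsilon>"
    using assms by (intro real_sqrt_le_mono) auto
  ultimately show ?thesis
    using reaction_hoelder[of 0 "max \<epsilon> z" "max 0 z"] lam
    by (smt (verit) mult_left_mono mult_nonneg_nonneg)
qed

text \<open>After truncation all relevant arguments are at least \<epsilon>, where -z ln z has slope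
  at most -ln \<epsilon>. The constant blows up with vanishing \<epsilon>, so it serves only to
  solve the problem at fixed \<epsilon>.\<close>

lemma reaction_lipschitz:
  assumes "0 < \<epsilon>" "\<epsilon> \<le> exp (- 1)"
  shows "\<bar>reaction lam \<epsilon> a - reaction lam \<epsilon> b\<bar> \<le> 2 * lam * (- ln \<epsilon>) * \<bar>a - b\<bar>"
proof -
  have ln\<epsilon>: "- ln \<epsilon> \<ge> 0" using assms by (smt (verit) ln_exp ln_mono)
  have wlog: "\<bar>entropy (max \<epsilon> a) - entropy (max \<epsilon> b)\<bar> \<le> (- ln \<epsilon>) * \<bar>a - b\<bar>" if "a \<le> b" for a b
  proof -
    define a' b' where "a' = clamp_inv_e (max \<epsilon> a)" and "b' = clamp_inv_e (max \<epsilon> b)"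
    have ab: "\<epsilon> \<le> a'" "a' \<le> b'" "b' \<le> exp (- 1)" "b' - a' \<le> b - a"
      using assms that by (auto simp: a'_def b'_def clamp_inv_e_def)
    have le: "entropy (max \<epsilon> a) \<le> entropy (max \<epsilon> b)" using that by (intro entropy_mono) auto
    have "entropy (max \<epsilon> b) - entropy (max \<epsilon> a) \<le> (b' - a') * (- ln \<epsilon>)"
    proof (cases "a' = b'")
      case True
      then show ?thesis by (simp add: entropy_def a'_def b'_def)
    next
      case False
      then have "entropy (max \<epsilon> b) - entropy (max \<epsilon> a) \<le> (b' - a') * (- ln b')"
        using mult_ln_diff_bounds(2)[of a' b'] ab assms by (simp add: entropy_def a'_def b'_def)
      also have "\<dots> \<le> (b' - a') * (- ln \<epsilon>)" using ab assms by (intro mult_left_mono) auto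
      finally show ?thesis .
    qed
    also have "\<dots> \<le> (b - a) * (- ln \<epsilon>)" using ab ln\<epsilon> by (intro mult_right_mono) auto
    finally show ?thesis using le that by (simp add: mult.commute)
  qed
  have "\<bar>entropy (max \<epsilon> a) - entropy (max \<epsilon> b)\<bar> \<le> (- ln \<epsilon>) * \<bar>a - b\<bar>"
    using wlog[of a b] wlog[of b a] by (cases "a \<le> b") (auto simp: abs_minus_commute)
  then have "2 * lam * \<bar>entropy (max \<epsilon> a) - entropy (max \<epsilon> b)\<bar> \<le> 2 * lam * ((- ln \<epsilon>) * \<bar>a - b\<bar>)"
    using lam by (intro mult_left_mono) auto
  moreover have "\<bar>reaction lam \<epsilon> a - reaction lam \<epsilon> b\<bar> = 2 * lam * \<bar>entropy (max \<epsilon> a) - entropy (max \<epsilon> b)\<bar>"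
    unfolding reaction_def using lam by (simp add: abs_mult flip: right_diff_distrib)
  ultimately show ?thesis by simp
qed

lemma reaction_continuous: "continuous_on S (reaction lam \<epsilon>)"
proof -
  have "((\<lambda>y. reaction lam \<epsilon> y) \<longlongrightarrow> reaction lam \<epsilon> x) (at x within S)" for x
  proof (rule Lim_null_comparison[THEN LIM_zero_cancel])
    show "\<forall>\<^sub>F y in at x within S. norm (reaction lam \<epsilon> y - reaction lam \<epsilon> x) \<le> 4 * lam * sqrt \<bar>y - x\<bar>"
      using reaction_hoelder by simp
    have "((\<lambda>y. 4 * lam * sqrt \<bar>y - x\<bar>) \<longlongrightarrow> 4 * lam * sqrt \<bar>x - x\<bar>) (at x within S)"
      by (intro tendsto_intros)
    then show "((\<lambda>y. 4 * lam * sqrt \<bar>y - x\<bar>) \<longlongrightarrow> 0) (at x within S)" by simp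
  qed
  then show ?thesis by (simp add: continuous_on_def)
qed

text \<open>The bound is the same for every \<open>W\<close>, so Picard iterates need no separate a
  priori estimate.\<close>

lemma bounded_source_reaction:
  assumes "continuous_on UNIV (\<lambda>(t, x). W t x)"
  shows "bounded_source (\<lambda>t x. - reaction lam \<epsilon> (W t x)) (4 * lam)"
proof
  show "continuous_on UNIV (\<lambda>(t :: real, x :: real). - reaction lam \<epsilon> (W t x))"
    using assms continuous_on_compose2[OF reaction_continuous[of UNIV]]
    unfolding case_prod_beta by (intro continuous_intros) blast
qed (rule reaction_bound)

end

lemma continuous_on_UNIV_atMost:
  fixes F :: "real \<times> real \<Rightarrow> real"
  assumes "\<And>T. continuous_on ({..T} \<times> UNIV) F"
  shows "continuous_on UNIV F"
  unfolding continuous_on_eq_continuous_at[OF open_UNIV]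
proof
  fix p :: "real \<times> real"
  have "continuous_on ({..<fst p + 1} \<times> UNIV) F"
    by (rule continuous_on_subset[OF assms[of "fst p + 1"]]) auto
  moreover have "open ({..<fst p + 1} \<times> (UNIV :: real set))" by (intro open_Times) auto
  moreover have "p \<in> {..<fst p + 1} \<times> UNIV" by (auto simp: mem_Times_iff)
  ultimately show "isCont F p" using continuous_on_eq_continuous_at by blast
qed

lemma duhamel0_bound_const:
  assumes "bounded_source g M" "\<And>s x. 0 < s \<Longrightarrow> s < t \<Longrightarrow> \<bar>g s x\<bar> \<le> e" "e \<ge> 0"
  shows "\<bar>duhamel heat0 g t x\<bar> \<le> e * \<bar>t\<bar>"
proof (cases "t \<ge> 0")
  case True
  interpret bounded_source g M by fact
  have "\<bar>duhamel heat0 g t x\<bar> \<le> e * t - e * 0"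
    using assms True by (intro duhamel0_le[where b = "\<lambda>_. e"]) (auto intro!: derivative_eq_intros)
  then show ?thesis using True by simp
next
  case False
  then have "duhamel heat0 g t x = 0" by (simp add: duhamel_def)
  then show ?thesis using assms(3) by simp
qed

lemma bounded_source_diff:
  assumes "bounded_source g M" "bounded_source h N"
  shows "bounded_source (\<lambda>t x. g t x - h t x) (M + N)"
proof
  interpret g: bounded_source g M by fact
  interpret h: bounded_source h N by fact
  show "continuous_on UNIV (\<lambda>(t, x). g t x - h t x)"
    using g.cont h.cont unfolding case_prod_beta by (intro continuous_intros)
  show "\<bar>g t x - h t x\<bar> \<le> M + N" for t x using g.bnd[of t x] h.bnd[of t x] by linarith
qed

lemma mild_bound:
  assumes f: "continuous_on UNIV f" "\<And>x. \<bar>f x\<bar> \<le> N" and g: "bounded_source g M"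
  shows "\<bar>mild f g t x\<bar> \<le> N + M * \<bar>t\<bar>"
proof -
  interpret bounded_source g M by fact
  have "\<bar>heat0 t f x\<bar> \<le> N" by (rule heat0_bound[OF f])
  moreover have "\<bar>duhamel heat0 g t x\<bar> \<le> M * \<bar>t\<bar>"
    using g bnd M_nonneg by (rule duhamel0_bound_const)
  ultimately show ?thesis unfolding mild_def by linarith
qed

text \<open>Passage to the limit in the mild formulation. The source is evaluated along \<open>V\<close>, not
  along \<open>W\<close> itself, so that the lemma also covers Picard iteration.\<close>

lemma mild_limit:
  assumes lam: "lam > 0" and f: "continuous_on UNIV f" "\<And>x. \<bar>f x\<bar> \<le> N"
    and contV: "\<And>n. continuous_on UNIV (\<lambda>(t, x). V n t x)"
    and W: "\<And>n t x. W n t x = mild f (\<lambda>t x. - reaction lam (\<epsilon> n) (V n t x)) t x"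
    and V_lim: "\<And>T. uniform_limit ({-T..T} \<times> UNIV) (\<lambda>n (t, x). V n t x) (\<lambda>(t, x). w t x) sequentially"
    and W_lim: "\<And>t x. (\<lambda>n. W n t x) \<longlonglongrightarrow> w t x"
    and approx: "\<And>n z. \<bar>reaction lam (\<epsilon> n) z - reaction lam \<delta> z\<bar> \<le> d n" "d \<longlonglongrightarrow> 0"
  shows "continuous_on UNIV (\<lambda>(t, x). w t x)"
    and "w t x = mild f (\<lambda>t x. - reaction lam \<delta> (w t x)) t x"
proof -
  show cont: "continuous_on UNIV (\<lambda>(t, x). w t x)"
    unfolding continuous_on_eq_continuous_at[OF open_UNIV]
  proof
    fix p :: "real \<times> real"
    define T where "T = \<bar>fst p\<bar> + 1"
    have "continuous_on ({-T..T} \<times> UNIV) (\<lambda>(t, x). w t x)"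
      by (rule uniform_limit_theorem[OF always_eventually V_lim])
        (auto intro: continuous_on_subset[OF contV])
    then have "continuous_on ({-T<..<T} \<times> UNIV) (\<lambda>(t, x). w t x)"
      by (rule continuous_on_subset) auto
    moreover have "open ({-T<..<T} \<times> (UNIV :: real set))" by (intro open_Times) auto
    moreover have "p \<in> {-T<..<T} \<times> UNIV" by (auto simp: mem_Times_iff T_def)
    ultimately show "isCont (\<lambda>(t, x). w t x) p" using continuous_on_eq_continuous_at by blast
  qed
  define g where "g = (\<lambda>t x. - reaction lam \<delta> (w t x))"
  define gn where "gn = (\<lambda>n t x. - reaction lam (\<epsilon> n) (V n t x))"
  have g: "bounded_source g (4 * lam)" unfolding g_def by (rule bounded_source_reaction[OF lam cont])
  have gn: "bounded_source (gn n) (4 * lam)" for n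
    unfolding gn_def by (rule bounded_source_reaction[OF lam contV])
  have "(\<lambda>n. mild f (gn n) t x) \<longlonglongrightarrow> mild f g t x"
  proof (rule LIMSEQ_I)
    fix e :: real assume e: "e > 0"
    define e' where "e' = e / 2 / (\<bar>t\<bar> + 1)"
    have e': "e' > 0" using e by (simp add: e'_def)
    \<comment> \<open>Inverse of the Hoelder modulus: closeness \<eta> of the arguments costs at
      most \<open>e'\<close> in the reaction. The change of truncation costs another
      \<open>e'\<close>, and integration over time multiplies the sum by at most
      \<open>\<bar>t\<bar>\<close>.\<close>
    define \<eta> where "\<eta> = (e' / (4 * lam))\<^sup>2"
    have \<eta>: "\<eta> > 0" "4 * lam * sqrt \<eta> = e'" using e' lam by (auto simp: \<eta>_def)
    have "\<forall>\<^sub>F n in sequentially. \<forall>p\<in>{-\<bar>t\<bar>..\<bar>t\<bar>} \<times> UNIV. dist ((\<lambda>(t, x). V n t x) p) ((\<lambda>(t, x). w t x) p) < \<eta>"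
      using uniform_limitD[OF V_lim \<eta>(1)] .
    moreover have "\<forall>\<^sub>F n in sequentially. d n < e'"
      using order_tendstoD(2)[OF approx(2) e'] .
    ultimately have "\<forall>\<^sub>F n in sequentially. norm (mild f (gn n) t x - mild f g t x) < e"
    proof eventually_elim
      case (elim n)
      have "\<bar>gn n s y - g s y\<bar> \<le> 2 * e'" if "0 < s" "s < t" for s y
      proof -
        have "(s, y) \<in> {-\<bar>t\<bar>..\<bar>t\<bar>} \<times> UNIV" using that by auto
        with elim(1) have "\<bar>V n s y - w s y\<bar> < \<eta>" by (force simp: dist_real_def)
        then have "4 * lam * sqrt \<bar>V n s y - w s y\<bar> \<le> 4 * lam * sqrt \<eta>"
          using lam by (intro mult_left_mono real_sqrt_le_mono) auto
        then have "\<bar>reaction lam \<delta> (V n s y) - reaction lam \<delta> (w s y)\<bar> \<le> e'"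
          using reaction_hoelder[OF lam, of \<delta> "V n s y" "w s y"] \<eta>(2) by linarith
        then show ?thesis using approx(1)[of n "V n s y"] elim(2) unfolding gn_def g_def by linarith
      qed
      then have "\<bar>duhamel heat0 (\<lambda>t x. gn n t x - g t x) t x\<bar> \<le> 2 * e' * \<bar>t\<bar>"
        using e' by (intro duhamel0_bound_const[OF bounded_source_diff[OF gn g]]) auto
      then have "\<bar>mild f (gn n) t x - mild f g t x\<bar> \<le> 2 * e' * \<bar>t\<bar>"
        unfolding mild_def duhamel0_diff[OF gn g] by simp
      also have "\<dots> < 2 * e' * (\<bar>t\<bar> + 1)" using e' by simp
      also have "\<dots> = e"
      proof -
        have "2 * (e / 2 / k) * k = e" if "k \<noteq> 0" for k :: real using that by simp
        from this[of "\<bar>t\<bar> + 1"] show ?thesis unfolding e'_def by linarith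
      qed
      finally show ?case by simp
    qed
    then show "\<exists>no. \<forall>n\<ge>no. norm (mild f (gn n) t x - mild f g t x) < e"
      by (simp add: eventually_sequentially)
  qed
  moreover have "(\<lambda>n. mild f (gn n) t x) \<longlonglongrightarrow> w t x"
    using W_lim[of t x] unfolding W gn_def .
  ultimately show "w t x = mild f (\<lambda>t x. - reaction lam \<delta> (w t x)) t x"
    unfolding g_def using LIMSEQ_unique by blast
qed


section \<open>Picard iteration at fixed truncation\<close>

lemma duhamel0_bound_exp:
  assumes "bounded_source g M" "\<And>s x. 0 < s \<Longrightarrow> s < t \<Longrightarrow> \<bar>g s x\<bar> \<le> c * exp (K * s)" "c \<ge> 0" "K > 0"
  shows "\<bar>duhamel heat0 g t x\<bar> \<le> c / K * exp (K * \<bar>t\<bar>)"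
proof (cases "t \<ge> 0")
  case True
  interpret bounded_source g M by fact
  have "\<bar>duhamel heat0 g t x\<bar> \<le> c / K * exp (K * t) - c / K * exp (K * 0)"
    using assms(2,4) True
    by (intro duhamel0_le[where b = "\<lambda>s. c * exp (K * s)"]) (auto intro!: derivative_eq_intros continuous_intros)
  also have "\<dots> \<le> c / K * exp (K * t)" using assms(3,4) by simp
  finally show ?thesis using True by simp
next
  case False
  then have "duhamel heat0 g t x = 0" by (simp add: duhamel_def)
  then show ?thesis using assms(3,4) by simp
qed

primrec picard :: "real \<Rightarrow> real \<Rightarrow> (real \<Rightarrow> real) \<Rightarrow> nat \<Rightarrow> real \<Rightarrow> real \<Rightarrow> real" where
  "picard lam \<epsilon> f 0 = mild f (\<lambda>_ _. 0)"
| "picard lam \<epsilon> f (Suc n) = mild f (\<lambda>t x. - reaction lam \<epsilon> (picard lam \<epsilon> f n t x))"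

definition mild_solution :: "real \<Rightarrow> real \<Rightarrow> (real \<Rightarrow> real) \<Rightarrow> (real \<Rightarrow> real \<Rightarrow> real) \<Rightarrow> bool" where
  "mild_solution lam \<epsilon> f w \<longleftrightarrow> continuous_on UNIV (\<lambda>(t, x). w t x) \<and>
     (\<forall>t x. w t x = mild f (\<lambda>t x. - reaction lam \<epsilon> (w t x)) t x)"

lemma mild_solution_continuous:
  "mild_solution lam \<epsilon> f w \<Longrightarrow> continuous_on S (\<lambda>(t, x). w t x)"
  unfolding mild_solution_def by (rule continuous_on_subset[OF _ subset_UNIV]) (rule conjunct1)

lemma bounded_source_zero: "bounded_source (\<lambda>_ _. 0) 0"
  by unfold_locales (auto simp: case_prod_beta)

lemma mild_diff:
  assumes "bounded_source g M" "bounded_source h N"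
  shows "mild f g t x - mild f h t x = duhamel heat0 (\<lambda>t x. g t x - h t x) t x"
  unfolding mild_def duhamel0_diff[OF assms] by simp

text \<open>Differences of iterates are measured against the weight
  \<open>exp (2 * L * \<bar>t\<bar>)\<close>: the Lipschitz constant contributes \<open>L\<close>,
  integrating the weight divides by \<open>2 * L\<close>, and each step gains a factor 1/2 on all
  times at once. Thus no continuation from short intervals is needed.\<close>

lemma mild_solution_exists_lipschitz:
  assumes lam: "lam > 0" and f: "continuous_on UNIV f" "\<And>x. \<bar>f x\<bar> \<le> N" and \<epsilon>: "0 < \<epsilon>" "\<epsilon> \<le> exp (- 1)"
  shows "\<exists>w. mild_solution lam \<epsilon> f w"
proof -
  define L where "L = 2 * lam * (- ln \<epsilon>)"
  have "ln \<epsilon> \<le> - 1" using \<epsilon> by (metis ln_exp ln_le_cancel_iff exp_gt_zero)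
  then have L: "L > 0" using lam unfolding L_def by (intro mult_pos_pos) auto
  define P where "P = picard lam \<epsilon> f"
  have P0: "P 0 = mild f (\<lambda>_ _. 0)" and PS: "P (Suc n) = mild f (\<lambda>t x. - reaction lam \<epsilon> (P n t x))" for n
    by (simp_all add: P_def)
  have contP: "continuous_on UNIV (\<lambda>(t, x). P n t x)" for n
  proof (induction n)
    case 0
    show ?case unfolding P0
      by (rule continuous_on_UNIV_atMost[OF mild_continuous[OF f bounded_source_zero]])
  next
    case (Suc n)
    show ?case unfolding PS
      by (rule continuous_on_UNIV_atMost[OF mild_continuous[OF f bounded_source_reaction[OF lam Suc]]])
  qed
  have src: "bounded_source (\<lambda>t x. - reaction lam \<epsilon> (P n t x)) (4 * lam)" for n
    by (rule bounded_source_reaction[OF lam contP])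
  define c where "c = (\<lambda>n :: nat. 4 * lam / 2 ^ n)"
  have diff: "\<bar>P (Suc n) t x - P n t x\<bar> \<le> c n / (2 * L) * exp (2 * L * \<bar>t\<bar>)" for n t x
  proof (induction n arbitrary: t x)
    case 0
    have "\<bar>duhamel heat0 (\<lambda>t x. - reaction lam \<epsilon> (P 0 t x) - 0) t x\<bar> \<le> c 0 / (2 * L) * exp (2 * L * \<bar>t\<bar>)"
    proof (rule duhamel0_bound_exp[OF bounded_source_diff[OF src bounded_source_zero]])
      fix s x :: real assume "0 < s"
      then have "1 \<le> exp (2 * L * s)" using L by simp
      then have "4 * lam * 1 \<le> 4 * lam * exp (2 * L * s)" using lam by (intro mult_left_mono) auto
      then show "\<bar>- reaction lam \<epsilon> (P 0 s x) - 0\<bar> \<le> c 0 * exp (2 * L * s)"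
        using reaction_bound[OF lam, of \<epsilon> "P 0 s x"] by (simp add: c_def)
    qed (use L lam in \<open>auto simp: c_def\<close>)
    moreover have "P (Suc 0) t x - P 0 t x = duhamel heat0 (\<lambda>t x. - reaction lam \<epsilon> (P 0 t x) - 0) t x"
      using mild_diff[OF src[of 0] bounded_source_zero, of f t x] by (simp only: PS P0)
    ultimately show ?case by (simp only:)
  next
    case (Suc n)
    have "\<bar>duhamel heat0 (\<lambda>t x. - reaction lam \<epsilon> (P (Suc n) t x) - - reaction lam \<epsilon> (P n t x)) t x\<bar>
        \<le> c (Suc n) / (2 * L) * exp (2 * L * \<bar>t\<bar>)"
    proof (rule duhamel0_bound_exp[OF bounded_source_diff[OF src src]])
      fix s x :: real assume s: "0 < s"
      have "\<bar>- reaction lam \<epsilon> (P (Suc n) s x) - - reaction lam \<epsilon> (P n s x)\<bar> \<le> L * \<bar>P (Suc n) s x - P n s x\<bar>"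
        using reaction_lipschitz[OF lam \<epsilon>, of "P (Suc n) s x" "P n s x"] unfolding L_def by linarith
      also have "\<dots> \<le> L * (c n / (2 * L) * exp (2 * L * \<bar>s\<bar>))" using Suc.IH L by (intro mult_left_mono) auto
      also have "\<dots> = c (Suc n) * exp (2 * L * s)" using L s by (simp add: c_def)
      finally show "\<bar>- reaction lam \<epsilon> (P (Suc n) s x) - - reaction lam \<epsilon> (P n s x)\<bar> \<le> c (Suc n) * exp (2 * L * s)" .
    qed (use L lam in \<open>auto simp: c_def\<close>)
    moreover have "P (Suc (Suc n)) t x - P (Suc n) t x
        = duhamel heat0 (\<lambda>t x. - reaction lam \<epsilon> (P (Suc n) t x) - - reaction lam \<epsilon> (P n t x)) t x"
      using mild_diff[OF src[of "Suc n"] src[of n], of f t x] by (simp only: PS)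
    ultimately show ?case by (simp only:)
  qed
  \<comment> \<open>The telescoping series of iterates; the geometric bound makes it converge
    uniformly on bounded time intervals.\<close>
  define w where "w = (\<lambda>t x. P 0 t x + (\<Sum>i. P (Suc i) t x - P i t x))"
  have P_lim: "uniform_limit ({-T..T} \<times> UNIV) (\<lambda>n (t, x). P n t x) (\<lambda>(t, x). w t x) sequentially" for T
  proof -
    have "uniform_limit ({-T..T} \<times> UNIV) (\<lambda>n p. \<Sum>i<n. P (Suc i) (fst p) (snd p) - P i (fst p) (snd p))
        (\<lambda>p. \<Sum>i. P (Suc i) (fst p) (snd p) - P i (fst p) (snd p)) sequentially"
    proof (rule Weierstrass_m_test)
      show "norm (P (Suc n) (fst p) (snd p) - P n (fst p) (snd p)) \<le> c n / (2 * L) * exp (2 * L * T)"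
        if "p \<in> {-T..T} \<times> UNIV" for n p
      proof -
        have "c n / (2 * L) * exp (2 * L * \<bar>fst p\<bar>) \<le> c n / (2 * L) * exp (2 * L * T)"
          using that L lam by (intro mult_left_mono) (auto simp: c_def abs_le_iff mem_Times_iff)
        then show ?thesis using diff[of n "fst p" "snd p"] by simp
      qed
      have "summable (\<lambda>n. 4 * lam / (2 * L) * exp (2 * L * T) * (1 / 2) ^ n)"
        by (intro summable_mult summable_geometric) simp
      then show "summable (\<lambda>n. c n / (2 * L) * exp (2 * L * T))"
        by (simp add: c_def power_divide field_simps)
    qed
    moreover have "uniform_limit ({-T..T} \<times> UNIV) (\<lambda>n p. P 0 (fst p) (snd p)) (\<lambda>p. P 0 (fst p) (snd p)) sequentially"
      by (rule uniform_limit_const)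
    ultimately have "uniform_limit ({-T..T} \<times> UNIV)
        (\<lambda>n p. P 0 (fst p) (snd p) + (\<Sum>i<n. P (Suc i) (fst p) (snd p) - P i (fst p) (snd p)))
        (\<lambda>p. P 0 (fst p) (snd p) + (\<Sum>i. P (Suc i) (fst p) (snd p) - P i (fst p) (snd p))) sequentially"
      by (intro uniform_limit_add)
    moreover have "P 0 t x + (\<Sum>i<n. P (Suc i) t x - P i t x) = P n t x" for n t x
      using sum_lessThan_telescope[of "\<lambda>i. P i t x" n] by simp
    ultimately
    show ?thesis by (simp add: w_def case_prod_beta')
  qed
  have "mild_solution lam \<epsilon> f w"
    unfolding mild_solution_def
  proof (intro conjI allI)
    \<comment> \<open>The values are those of \<open>P (Suc n)\<close> while the sources are
      evaluated along \<open>P n\<close>, so convergence of the shifted sequence is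
      required.\<close>
    have W_lim: "(\<lambda>n. P (Suc n) t x) \<longlonglongrightarrow> w t x" for t x
    proof -
      have "- \<bar>t\<bar> \<le> t" "t \<le> \<bar>t\<bar>" by linarith+
      then show ?thesis
        using tendsto_uniform_limitI[OF P_lim[of "\<bar>t\<bar>"], of "(t, x)"] by (intro LIMSEQ_Suc) simp
    qed
    show "continuous_on UNIV (\<lambda>(t, x). w t x)"
      by (rule mild_limit(1)[OF lam f contP _ P_lim W_lim, of "\<lambda>_. \<epsilon>" \<epsilon> "\<lambda>_. 0"]) (auto simp: PS)
    show "w t x = mild f (\<lambda>t x. - reaction lam \<epsilon> (w t x)) t x" for t x
      by (rule mild_limit(2)[OF lam f contP _ P_lim W_lim, of "\<lambda>_. \<epsilon>" \<epsilon> "\<lambda>_. 0"]) (auto simp: PS)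
  qed
  then show ?thesis by blast
qed

text \<open>At \<open>t = 0\<close> this yields the initial values; for negative times it shows that
  mild solutions with the same data agree whatever their source.\<close>

lemma mild_nonpos_time: "t \<le> 0 \<Longrightarrow> mild f g t x = heat0 t f x"
  by (simp add: mild_def duhamel_def)

section \<open>Comparison of mild solutions and removal of the truncation\<close>

locale mild_problem =
  fixes lam N L :: real and f :: "real \<Rightarrow> real"
  assumes lam: "lam > 0" and f_cont: "continuous_on UNIV f" and f_bound: "\<And>x. \<bar>f x\<bar> \<le> N"
    and f_lipschitz: "\<And>x y. \<bar>f x - f y\<bar> \<le> L * \<bar>x - y\<bar>"
begin

text \<open>Bootstrap: boundedness of the source makes the solution Lipschitz in space, and the
  Hoelder reaction then makes the source Hoelder. Lipschitz initial data keep the constant uniform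
  down to \<open>t = 0\<close>.\<close>

lemma solution_source:
  assumes "mild_solution lam \<epsilon> f w"
  shows "hoelder_source (\<lambda>t x. - reaction lam \<epsilon> (w t x)) (4 * lam)"
proof -
  have w: "continuous_on UNIV (\<lambda>(t, x). w t x)" "\<And>t x. w t x = mild f (\<lambda>t x. - reaction lam \<epsilon> (w t x)) t x"
    using assms unfolding mild_solution_def by blast+
  interpret bounded_source "\<lambda>t x. - reaction lam \<epsilon> (w t x)" "4 * lam"
    by (rule bounded_source_reaction[OF lam w(1)])
  show ?thesis
  proof
    fix T :: real
    define C where "C = L + 4 * lam * heat1_const * (\<integral>r. indicator {0<..<T} r * r powr (- 1 / 2) \<partial>lborel)"
    have lip: "\<bar>w t x - w t y\<bar> \<le> C * \<bar>x - y\<bar>" if "t \<le> T" for t x y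
    proof -
      have "\<bar>heat0 t f x - heat0 t f y\<bar> \<le> L * \<bar>x - y\<bar>"
        by (rule heat0_lipschitz[OF f_cont f_bound f_lipschitz])
      then show ?thesis
        using duhamel0_lipschitz[OF that, of x y] w(2)[of t x] w(2)[of t y]
        unfolding mild_def C_def distrib_right by linarith
    qed
    have "\<bar>- reaction lam \<epsilon> (w t x) - - reaction lam \<epsilon> (w t y)\<bar> \<le> 4 * lam * sqrt C * sqrt \<bar>x - y\<bar>"
      if "t \<in> {0..T}" for t x y
    proof -
      have "4 * lam * sqrt \<bar>w t x - w t y\<bar> \<le> 4 * lam * sqrt (C * \<bar>x - y\<bar>)"
        using lam that lip by (intro mult_left_mono real_sqrt_le_mono) auto
      then show ?thesis
        using reaction_hoelder[OF lam, of \<epsilon> "w t x" "w t y"] by (simp add: real_sqrt_mult)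
    qed
    then show "\<exists>K. \<forall>t\<in>{0..T}. \<forall>x y. \<bar>- reaction lam \<epsilon> (w t x) - - reaction lam \<epsilon> (w t y)\<bar> \<le> K * sqrt \<bar>x - y\<bar>"
      by blast
  qed
qed

lemma solution_derivs:
  assumes "mild_solution lam \<epsilon> f w"
  obtains wx wxx where
    "\<And>t x. t > 0 \<Longrightarrow> ((\<lambda>t. w t x) has_real_derivative wxx t x - reaction lam \<epsilon> (w t x)) (at t)"
    "\<And>t x. t > 0 \<Longrightarrow> ((\<lambda>x. w t x) has_real_derivative wx t x) (at x)"
    "\<And>t x. t > 0 \<Longrightarrow> ((\<lambda>x. wx t x) has_real_derivative wxx t x) (at x)"
    "\<And>T. continuous_on ({0<..T} \<times> UNIV) (\<lambda>(t, x). wx t x)"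
    "\<And>T. continuous_on ({0<..T} \<times> UNIV) (\<lambda>(t, x). wxx t x)"
proof -
  define g where "g = (\<lambda>t x. - reaction lam \<epsilon> (w t x))"
  have g: "hoelder_source g (4 * lam)" unfolding g_def by (rule solution_source[OF assms])
  have w: "w = mild f g" using assms unfolding mild_solution_def g_def by blast
  note d = mild_derivs[OF f_cont f_bound g, folded w]
  show thesis
    by (rule that[of "mild_xx f g" "mild_x f g"]) (use d in \<open>auto simp: g_def\<close>)
qed

lemma solution_bound:
  assumes "mild_solution lam \<epsilon> f w"
  shows "\<bar>w t x\<bar> \<le> N + 4 * lam * \<bar>t\<bar>"
proof -
  have w: "continuous_on UNIV (\<lambda>(t, x). w t x)" "w t x = mild f (\<lambda>t x. - reaction lam \<epsilon> (w t x)) t x"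
    using assms unfolding mild_solution_def by blast+
  show ?thesis
    unfolding w(2) by (rule mild_bound[OF f_cont f_bound bounded_source_reaction[OF lam w(1)]])
qed

lemma solution_nonpos_time:
  assumes "mild_solution lam \<epsilon> f w" "t \<le> 0"
  shows "w t x = heat0 t f x"
  using assms mild_nonpos_time unfolding mild_solution_def by metis

text \<open>The maximum principle is applied to \<open>v t x - w t x - d * t\<close>. The linear
  term pays for the mismatch of the two reactions; monotonicity handles the rest, so no Lipschitz
  constant enters.\<close>

lemma solution_compare:
  assumes v: "mild_solution lam \<epsilon> f v" and w: "mild_solution lam \<delta> f w"
    and close: "\<And>z. \<bar>reaction lam \<epsilon> z - reaction lam \<delta> z\<bar> \<le> d" and t: "t \<ge> 0"
  shows "v t x - w t x \<le> d * t"
proof -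
  obtain vx vxx where v':
    "\<And>t x. t > 0 \<Longrightarrow> ((\<lambda>t. v t x) has_real_derivative vxx t x - reaction lam \<epsilon> (v t x)) (at t)"
    "\<And>t x. t > 0 \<Longrightarrow> ((\<lambda>x. v t x) has_real_derivative vx t x) (at x)"
    "\<And>t x. t > 0 \<Longrightarrow> ((\<lambda>x. vx t x) has_real_derivative vxx t x) (at x)"
    using solution_derivs[OF v] by metis
  obtain wx wxx where w':
    "\<And>t x. t > 0 \<Longrightarrow> ((\<lambda>t. w t x) has_real_derivative wxx t x - reaction lam \<delta> (w t x)) (at t)"
    "\<And>t x. t > 0 \<Longrightarrow> ((\<lambda>x. w t x) has_real_derivative wx t x) (at x)"
    "\<And>t x. t > 0 \<Longrightarrow> ((\<lambda>x. wx t x) has_real_derivative wxx t x) (at x)"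
    using solution_derivs[OF w] by metis
  have d: "d \<ge> 0" using close[of 0] by linarith
  have "v t x - w t x - d * t \<le> 0"
  proof (rule maximum_principle[where T = t and B = "(N + 4 * lam * t) + (N + 4 * lam * t)" and z = "\<lambda>t x. v t x - w t x - d * t"
        and zt = "\<lambda>t x. (vxx t x - reaction lam \<epsilon> (v t x)) - (wxx t x - reaction lam \<delta> (w t x)) - d"
        and zx = "\<lambda>t x. vx t x - wx t x" and zxx = "\<lambda>t x. vxx t x - wxx t x"])
    have "continuous_on ({0..t} \<times> UNIV) (\<lambda>(t, x). v t x)" "continuous_on ({0..t} \<times> UNIV) (\<lambda>(t, x). w t x)"
      by (intro mild_solution_continuous[OF v] mild_solution_continuous[OF w])+
    then show "continuous_on ({0..t} \<times> UNIV) (\<lambda>(t, x). v t x - w t x - d * t)"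
      unfolding case_prod_beta by (intro continuous_intros) auto
    show "v s x - w s x - d * s \<le> (N + 4 * lam * t) + (N + 4 * lam * t)" if s: "s \<in> {0..t}" for s x
    proof -
      have le: "4 * lam * \<bar>s\<bar> \<le> 4 * lam * t" using s lam by (intro mult_left_mono) auto
      have "v s x \<le> N + 4 * lam * t"
        using le solution_bound[OF v, of s x] by linarith
      moreover have "- w s x \<le> N + 4 * lam * t"
        using le solution_bound[OF w, of s x] by linarith
      moreover have "d * s \<ge> 0" using s d by simp
      ultimately show ?thesis by linarith
    qed
    show "v 0 x - w 0 x - d * 0 \<le> 0" for x
      using solution_nonpos_time[OF v, of 0 x] solution_nonpos_time[OF w, of 0 x] by simp
    fix s x assume "s \<in> {0<..t}"
    then have s: "s > 0" by simp
    show "((\<lambda>s. v s x - w s x - d * s) has_real_derivative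
        (vxx s x - reaction lam \<epsilon> (v s x)) - (wxx s x - reaction lam \<delta> (w s x)) - d) (at s within {0<..t})"
    proof -
      have "((\<lambda>s. d * s) has_real_derivative d) (at s within {0<..t})"
        by (auto intro!: derivative_eq_intros)
      then show ?thesis
        by (intro DERIV_diff has_field_derivative_at_within[OF v'(1)[OF s]] has_field_derivative_at_within[OF w'(1)[OF s]])
    qed
    show "((\<lambda>y. v s y - w s y - d * s) has_real_derivative vx s x - wx s x) (at x)"
      using DERIV_diff[OF DERIV_diff[OF v'(2)[OF s] w'(2)[OF s]] DERIV_const[of "d * s"]] by simp
    show "((\<lambda>y. vx s y - wx s y) has_real_derivative vxx s x - wxx s x) (at x)"
      by (intro DERIV_diff v'(3) w'(3) s)
    assume "0 < v s x - w s x - d * s"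
    moreover have "d * s \<ge> 0" using s d by simp
    \<comment> \<open>At such points \<open>v\<close> exceeds \<open>w\<close>, so \<open>v\<close>
      is absorbed at least as strongly. Only the difference of the two reactions at the same value
      \<open>w s x\<close> remains, and it is at most \<open>d\<close>.\<close>
    ultimately have "reaction lam \<epsilon> (w s x) \<le> reaction lam \<epsilon> (v s x)" by (intro reaction_mono lam) simp
    with close[of "w s x"]
    show "(vxx s x - reaction lam \<epsilon> (v s x)) - (wxx s x - reaction lam \<delta> (w s x)) - d \<le> vxx s x - wxx s x"
      by linarith
  qed (use t in auto)
  then show ?thesis by simp
qed

lemma solution_abs_compare:
  assumes v: "mild_solution lam \<epsilon> f v" and w: "mild_solution lam \<delta> f w"
    and close: "\<And>z. \<bar>reaction lam \<epsilon> z - reaction lam \<delta> z\<bar> \<le> d"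
  shows "\<bar>v t x - w t x\<bar> \<le> d * \<bar>t\<bar>"
proof (cases "t \<ge> 0")
  case True
  have "\<bar>reaction lam \<delta> z - reaction lam \<epsilon> z\<bar> \<le> d" for z using close[of z] by linarith
  then show ?thesis
    using solution_compare[OF v w close True, of x] solution_compare[OF w v _ True, of d x] True by auto
next
  case False
  have "d \<ge> 0" using close[of 0] by linarith
  then have "0 \<le> d * \<bar>t\<bar>" by simp
  moreover have "v t x - w t x = 0"
    using False solution_nonpos_time[OF v, of t x] solution_nonpos_time[OF w, of t x] by simp
  ultimately show ?thesis by simp
qed

lemma mild_solution_exists: "\<exists>w. mild_solution lam 0 f w"
proof -
  \<comment> \<open>A null sequence inside (0, 1/e], the range in which the truncated problem has
    been solved.\<close>
  define \<epsilon> where "\<epsilon> = (\<lambda>n. exp (- 1) * inverse (real (Suc n)))"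
  have \<epsilon>: "0 < \<epsilon> n" "\<epsilon> n \<le> exp (- 1)" for n
    by (auto simp: \<epsilon>_def inverse_le_1_iff)
  have "\<forall>n. \<exists>w. mild_solution lam (\<epsilon> n) f w"
    using mild_solution_exists_lipschitz[OF lam f_cont f_bound \<epsilon>] by blast
  then obtain W where W: "\<And>n. mild_solution lam (\<epsilon> n) f (W n)" by metis
  define d where "d = (\<lambda>n. 4 * lam * sqrt (\<epsilon> n))"
  have approx: "\<bar>reaction lam (\<epsilon> n) z - reaction lam 0 z\<bar> \<le> d n" for n z
    unfolding d_def using \<epsilon>(1)[of n] by (intro reaction_approx[OF lam]) simp
  have "\<epsilon> \<longlonglongrightarrow> exp (- 1) * 0"
    unfolding \<epsilon>_def by (intro tendsto_intros LIMSEQ_inverse_real_of_nat)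
  then have "d \<longlonglongrightarrow> 4 * lam * sqrt (exp (- 1) * 0)"
    unfolding d_def by (intro tendsto_intros)
  then have d0: "d \<longlonglongrightarrow> 0" by simp
  have close: "\<bar>W m t x - W n t x\<bar> \<le> (d m + d n) * \<bar>t\<bar>" for m n t x
  proof (rule solution_abs_compare[OF W W])
    show "\<bar>reaction lam (\<epsilon> m) z - reaction lam (\<epsilon> n) z\<bar> \<le> d m + d n" for z
      using approx[of m z] approx[of n z] by linarith
  qed
  define w where "w = (\<lambda>t x. lim (\<lambda>n. W n t x))"
  have W_lim: "uniform_limit ({-T..T} \<times> UNIV) (\<lambda>n (t, x). W n t x) (\<lambda>(t, x). w t x) sequentially" for T
  proof -
    have "uniformly_Cauchy_on ({-T..T} \<times> UNIV) (\<lambda>n (t, x). W n t x)"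
      unfolding uniformly_Cauchy_on_def
    proof (intro allI impI)
      fix e :: real assume e: "e > 0"
      define e' where "e' = e / 2 / (\<bar>T\<bar> + 1)"
      have e': "e' > 0" using e by (simp add: e'_def)
      have T: "2 * e' * (\<bar>T\<bar> + 1) = e"
      proof -
        have "2 * (e / 2 / k) * k = e" if "k \<noteq> 0" for k :: real using that by simp
        from this[of "\<bar>T\<bar> + 1"] show ?thesis unfolding e'_def by linarith
      qed
      from order_tendstoD(2)[OF d0 e'] obtain n0 where n0: "\<And>n. n \<ge> n0 \<Longrightarrow> d n < e'"
        by (auto simp: eventually_sequentially)
      have "dist (W m t x) (W n t x) < e" if "m \<ge> n0" "n \<ge> n0" "t \<in> {-T..T}" for m n t x
      proof -
        have "(d m + d n) * \<bar>t\<bar> \<le> (2 * e') * \<bar>T\<bar>"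
          using n0[OF that(1)] n0[OF that(2)] that(3) e' by (intro mult_mono) auto
        also have "\<dots> < 2 * e' * (\<bar>T\<bar> + 1)" using e' by simp
        finally show ?thesis using close[of m t x n] T by (simp add: dist_real_def)
      qed
      then show "\<exists>M. \<forall>x\<in>{-T..T} \<times> UNIV. \<forall>m\<ge>M. \<forall>n\<ge>M. dist (case x of (t, x) \<Rightarrow> W m t x) (case x of (t, x) \<Rightarrow> W n t x) < e"
        by (intro exI[of _ n0]) auto
    qed
    then have "uniform_limit ({-T..T} \<times> UNIV) (\<lambda>n (t, x). W n t x) (\<lambda>p. lim (\<lambda>n. case p of (t, x) \<Rightarrow> W n t x)) sequentially"
      unfolding uniformly_convergent_uniform_limit_iff[symmetric] by (rule Cauchy_uniformly_convergent)
    moreover have "(\<lambda>p. lim (\<lambda>n. case p of (t, x) \<Rightarrow> W n t x)) = (\<lambda>(t, x). w t x)" by (auto simp: w_def)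
    ultimately show ?thesis by simp
  qed
  have lim: "(\<lambda>n. W n t x) \<longlonglongrightarrow> w t x" for t x
  proof -
    have "- \<bar>t\<bar> \<le> t" "t \<le> \<bar>t\<bar>" by linarith+
    then show ?thesis using tendsto_uniform_limitI[OF W_lim[of "\<bar>t\<bar>"], of "(t, x)"] by simp
  qed
  have contW: "continuous_on UNIV (\<lambda>(t, x). W n t x)"
    and eqW: "W n t x = mild f (\<lambda>t x. - reaction lam (\<epsilon> n) (W n t x)) t x" for n t x
    using W unfolding mild_solution_def by blast+
  have "mild_solution lam 0 f w"
    unfolding mild_solution_def
    \<comment> \<open>Here sources are evaluated along the solutions themselves, and the truncation
      parameters tend to 0.\<close>
    using mild_limit[OF lam f_cont f_bound contW eqW W_lim lim approx d0] by blast
  then show ?thesis by blast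
qed

text \<open>Where \<open>w\<close> is negative the reaction vanishes, so \<open>- w\<close>
  satisfies the heat equation there; everywhere the reaction is nonnegative, so \<open>w\<close> is
  a subsolution of the heat equation and cannot exceed its initial bound.\<close>

lemma solution_range:
  assumes w: "mild_solution lam 0 f w" and f: "\<And>x. 0 \<le> f x" "\<And>x. f x \<le> b" and t: "t \<ge> 0"
  shows "0 \<le> w t x" and "w t x \<le> b"
proof -
  obtain wx wxx where w':
    "\<And>t x. t > 0 \<Longrightarrow> ((\<lambda>t. w t x) has_real_derivative wxx t x - reaction lam 0 (w t x)) (at t)"
    "\<And>t x. t > 0 \<Longrightarrow> ((\<lambda>x. w t x) has_real_derivative wx t x) (at x)"
    "\<And>t x. t > 0 \<Longrightarrow> ((\<lambda>x. wx t x) has_real_derivative wxx t x) (at x)"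
    using solution_derivs[OF w] by metis
  have w0: "w 0 x = f x" for x using solution_nonpos_time[OF w, of 0 x] by simp
  have cont: "continuous_on ({0..t} \<times> UNIV) (\<lambda>(t, x). w t x)"
    by (rule mild_solution_continuous[OF w])
  have bound: "\<bar>w s x\<bar> \<le> N + 4 * lam * t" if "s \<in> {0..t}" for s x
  proof -
    have "4 * lam * \<bar>s\<bar> \<le> 4 * lam * t" using that lam by (intro mult_left_mono) auto
    then show ?thesis using solution_bound[OF w, of s x] by linarith
  qed
  have "- w t x \<le> 0"
  proof (rule maximum_principle[where T = t and B = "N + 4 * lam * t" and z = "\<lambda>t x. - w t x"
        and zt = "\<lambda>t x. - (wxx t x - reaction lam 0 (w t x))" and zx = "\<lambda>t x. - wx t x" and zxx = "\<lambda>t x. - wxx t x"])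
    show "continuous_on ({0..t} \<times> UNIV) (\<lambda>(t, x). - w t x)"
      using cont unfolding case_prod_beta by (intro continuous_intros)
    show "- w s x \<le> N + 4 * lam * t" if "s \<in> {0..t}" for s x using bound[OF that, of x] by linarith
    show "- w 0 x \<le> 0" for x using f(1) w0 by simp
    fix s x assume "s \<in> {0<..t}"
    then have s: "s > 0" by simp
    show "((\<lambda>s. - w s x) has_real_derivative - (wxx s x - reaction lam 0 (w s x))) (at s within {0<..t})"
      by (intro DERIV_minus has_field_derivative_at_within[OF w'(1)[OF s]])
    show "((\<lambda>y. - w s y) has_real_derivative - wx s x) (at x)" by (intro DERIV_minus w'(2) s)
    show "((\<lambda>y. - wx s y) has_real_derivative - wxx s x) (at x)" by (intro DERIV_minus w'(3) s)
    show "- (wxx s x - reaction lam 0 (w s x)) \<le> - wxx s x" if "0 < - w s x"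
      using that entropy_nonpos_arg[of 0] by (simp add: reaction_def)
  qed (use t in auto)
  then show "0 \<le> w t x" by simp
  have "w t x - b \<le> 0"
  proof (rule maximum_principle[where T = t and B = "N + 4 * lam * t - b" and z = "\<lambda>t x. w t x - b"
        and zt = "\<lambda>t x. wxx t x - reaction lam 0 (w t x)" and zx = wx and zxx = wxx])
    show "continuous_on ({0..t} \<times> UNIV) (\<lambda>(t, x). w t x - b)"
      using cont unfolding case_prod_beta by (intro continuous_intros)
    show "w s x - b \<le> N + 4 * lam * t - b" if "s \<in> {0..t}" for s x using bound[OF that, of x] by linarith
    show "w 0 x - b \<le> 0" for x using f(2) w0 by simp
    fix s x assume "s \<in> {0<..t}"
    then have s: "s > 0" by simp
    show "((\<lambda>s. w s x - b) has_real_derivative wxx s x - reaction lam 0 (w s x)) (at s within {0<..t})"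
      using DERIV_diff[OF has_field_derivative_at_within[OF w'(1)[OF s]] DERIV_const] by simp
    show "((\<lambda>y. w s y - b) has_real_derivative wx s x) (at x)"
      using DERIV_diff[OF w'(2)[OF s] DERIV_const] by simp
    show "((\<lambda>y. wx s y) has_real_derivative wxx s x) (at x)" by (intro w'(3) s)
    show "wxx s x - reaction lam 0 (w s x) \<le> wxx s x" using reaction_nonneg[OF lam, of 0 "w s x"] by simp
  qed (use t in auto)
  then show "w t x \<le> b" by simp
qed

end

section \<open>Rescaling and return to the original equation\<close>

lemma solution_exists:
  assumes lam: "lam > 0" and u0: "u0 \<in> BPC2" "\<And>x. u0 x \<ge> 0"
  shows "\<exists>u. global_solution lam u0 u"
proof -
  obtain u0' where cont: "continuous_on UNIV u0" and bnd: "bounded (range u0)"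
    and d: "\<And>x. (u0 has_real_derivative u0' x) (at x)" and bnd': "bounded (range u0')"
    using u0(1) unfolding BPC2_def by blast
  obtain B where B: "\<And>x. \<bar>u0 x\<bar> \<le> B" using bnd unfolding bounded_iff by auto
  obtain L where L: "\<And>x. \<bar>u0' x\<bar> \<le> L" using bnd' unfolding bounded_iff by auto
  have lip: "\<bar>u0 x - u0 y\<bar> \<le> L * \<bar>x - y\<bar>" for x y
    using field_differentiable_bound[of UNIV u0 u0' L x y] L d by (auto intro: has_field_derivative_at_within)
  \<comment> \<open>Chosen so that \<open>exp (- A)\<close> times the bound \<open>max 1 B\<close>
    is exactly 1/e. The \<open>max 1\<close> ensures that \<open>A\<close> is nonnegative, hence
    that \<open>E\<close> below is largest at the final time.\<close>
  define A where "A = 1 + ln (max 1 B)"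
  have A: "A \<ge> 0" unfolding A_def by (simp add: add_nonneg_nonneg)
  define f where "f = (\<lambda>x. exp (- A) * u0 x)"
  have expA: "exp (- A) = exp (- 1) / max 1 B" by (simp add: A_def exp_add exp_minus exp_diff field_simps)
  have f_range: "0 \<le> f x" "f x \<le> exp (- 1)" for x
  proof -
    show "0 \<le> f x" using u0(2) by (simp add: f_def)
    have "f x \<le> exp (- A) * max 1 B" unfolding f_def using B[of x] by (intro mult_left_mono) auto
    also have "\<dots> = exp (- 1)" unfolding expA by simp
    finally show "f x \<le> exp (- 1)" .
  qed
  interpret mild_problem lam "exp (- 1)" "exp (- A) * L" f
  proof
    show "continuous_on UNIV f" unfolding f_def using cont by (intro continuous_intros)
    show "\<bar>f x\<bar> \<le> exp (- 1)" for x using f_range[of x] by simp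
    show "\<bar>f x - f y\<bar> \<le> exp (- A) * L * \<bar>x - y\<bar>" for x y
      using lip[of x y] by (simp add: f_def abs_mult mult.assoc flip: right_diff_distrib)
  qed fact
  obtain w where w: "mild_solution lam 0 f w" using mild_solution_exists by blast
  have w_range: "0 \<le> w t x" "w t x \<le> exp (- 1)" if "t \<ge> 0" for t x
    using solution_range[OF w f_range that] by auto
  have w0: "w 0 x = f x" for x using solution_nonpos_time[OF w, of 0 x] by simp
  obtain wx wxx where w':
    "\<And>t x. t > 0 \<Longrightarrow> ((\<lambda>t. w t x) has_real_derivative wxx t x - reaction lam 0 (w t x)) (at t)"
    "\<And>t x. t > 0 \<Longrightarrow> ((\<lambda>x. w t x) has_real_derivative wx t x) (at x)"
    "\<And>t x. t > 0 \<Longrightarrow> ((\<lambda>x. wx t x) has_real_derivative wxx t x) (at x)"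
    "\<And>T. continuous_on ({0<..T} \<times> UNIV) (\<lambda>(t, x). wx t x)"
    "\<And>T. continuous_on ({0<..T} \<times> UNIV) (\<lambda>(t, x). wxx t x)"
    using solution_derivs[OF w] by metis
  \<comment> \<open>Solves E' = 2 lam E. In the equation for exp(E) w, the time derivative of the
    factor cancels the term 2 lam E u coming from ln u = E + ln w.\<close>
  define E where "E = (\<lambda>t. A * exp (2 * lam * t))"
  have E: "(E has_real_derivative 2 * lam * E t) (at t)" for t
    unfolding E_def by (auto intro!: derivative_eq_intros)
  have contE: "continuous_on S (\<lambda>p :: real \<times> real. E (fst p))" for S
    unfolding E_def by (intro continuous_intros)
  define u where "u = (\<lambda>t x. exp (E t) * w t x)"
  define ut where "ut = (\<lambda>t x. exp (E t) * (wxx t x - reaction lam 0 (w t x)) + 2 * lam * E t * exp (E t) * w t x)"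
  define ux where "ux = (\<lambda>t x. exp (E t) * wx t x)"
  define uxx where "uxx = (\<lambda>t x. exp (E t) * wxx t x)"
  have contw: "continuous_on S (\<lambda>p. w (fst p) (snd p))" for S
    using mild_solution_continuous[OF w] unfolding case_prod_beta .
  have contr: "continuous_on S (\<lambda>p. reaction lam 0 (w (fst p) (snd p)))" for S
    by (rule continuous_on_compose2[OF reaction_continuous[OF lam, of UNIV] contw]) auto
  have equation: "ut t x = uxx t x + log_nonlinearity lam (u t x)" if t: "t > 0" for t x
  proof (cases "w t x = 0")
    case True
    then show ?thesis
      using entropy_nonpos_arg[of 0] by (simp add: ut_def uxx_def u_def log_nonlinearity_def reaction_def)
  next
    case False
    then have pos: "w t x > 0" using w_range(1)[of t x] t by simp
    \<comment> \<open>The range [0, 1/e] makes both the truncation at 0 and the clamping inactive,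
      so the auxiliary reaction is the genuine nonlinearity.\<close>
    then have "clamp_inv_e (max 0 (w t x)) = w t x"
      using w_range(2)[of t x] t by (simp add: clamp_inv_e_def)
    then have "reaction lam 0 (w t x) = - (2 * lam * (w t x * ln (w t x)))"
      by (simp add: reaction_def entropy_def)
    moreover have "log_nonlinearity lam (u t x) = 2 * lam * (exp (E t) * w t x * (E t + ln (w t x)))"
      using pos by (simp add: u_def log_nonlinearity_pos ln_mult)
    ultimately show ?thesis unfolding ut_def uxx_def by (simp add: algebra_simps)
  qed
  have "solution_upto lam u0 T u" if T: "T > 0" for T
  proof -
    define C where "C = exp (A * exp (2 * lam * T)) * exp (- 1)"
    have u_bound: "\<bar>u t x\<bar> \<le> C" if t: "t \<in> {0..T}" for t x
    proof -
      have "E t \<le> A * exp (2 * lam * T)" unfolding E_def using t lam A by (intro mult_left_mono) auto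
      then have "exp (E t) * w t x \<le> C" unfolding C_def using w_range[of t x] t by (intro mult_mono) auto
      then show ?thesis using w_range(1)[of t x] t by (simp add: u_def)
    qed
    show ?thesis unfolding solution_upto_def
    proof (intro conjI)
      show "continuous_on ({0..T} \<times> UNIV) (\<lambda>(t, x). u t x)"
        unfolding u_def case_prod_beta by (intro continuous_intros contE contw)
      show "bounded ((\<lambda>(t, x). u t x) ` ({0..T} \<times> UNIV))"
        unfolding bounded_iff using u_bound by (intro exI[of _ C]) auto
      show "\<exists>M R. \<forall>t\<in>{0..T}. \<forall>x. \<bar>x\<bar> \<ge> R \<longrightarrow> \<bar>u t x\<bar> \<le> M" using u_bound by blast
      show "\<forall>x. u 0 x = u0 x"
        by (simp add: u_def E_def w0 f_def flip: exp_add mult.assoc)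
      show "\<exists>ut ux uxx.
        (\<forall>t\<in>{0<..T}. \<forall>x.
           ((\<lambda>s. u s x) has_real_derivative ut t x) (at t within {0<..T}) \<and>
           ((\<lambda>y. u t y) has_real_derivative ux t x) (at x) \<and>
           ((\<lambda>y. ux t y) has_real_derivative uxx t x) (at x)) \<and>
        continuous_on ({0<..T} \<times> UNIV) (\<lambda>(t, x). ut t x) \<and>
        continuous_on ({0<..T} \<times> UNIV) (\<lambda>(t, x). ux t x) \<and>
        continuous_on ({0<..T} \<times> UNIV) (\<lambda>(t, x). uxx t x) \<and>
        (\<forall>t\<in>{0<..T}. \<forall>x. ut t x = uxx t x + log_nonlinearity lam (u t x))"
      proof (rule exI[of _ ut], rule exI[of _ ux], rule exI[of _ uxx], intro conjI ballI allI)
        note wx_cont = w'(4)[of T, unfolded case_prod_beta] and wxx_cont = w'(5)[of T, unfolded case_prod_beta]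
        show "continuous_on ({0<..T} \<times> UNIV) (\<lambda>(t, x). ut t x)"
          unfolding ut_def case_prod_beta by (intro continuous_intros contE contw contr wxx_cont)
        show "continuous_on ({0<..T} \<times> UNIV) (\<lambda>(t, x). ux t x)"
          unfolding ux_def case_prod_beta by (intro continuous_intros contE wx_cont)
        show "continuous_on ({0<..T} \<times> UNIV) (\<lambda>(t, x). uxx t x)"
          unfolding uxx_def case_prod_beta by (intro continuous_intros contE wxx_cont)
        fix t x assume "t \<in> {0<..T}"
        then have t: "t > 0" by simp
        have "((\<lambda>s. exp (E s)) has_real_derivative exp (E t) * (2 * lam * E t)) (at t)"
          by (rule DERIV_chain2[OF DERIV_exp E])
        from DERIV_mult[OF this w'(1)[OF t, of x]]
        have "((\<lambda>s. u s x) has_real_derivative ut t x) (at t)"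
          unfolding u_def ut_def by (simp add: algebra_simps)
        then show "((\<lambda>s. u s x) has_real_derivative ut t x) (at t within {0<..T})"
          by (rule has_field_derivative_at_within)
        show "((\<lambda>y. u t y) has_real_derivative ux t x) (at x)"
          unfolding u_def ux_def by (intro DERIV_cmult w'(2) t)
        show "((\<lambda>y. ux t y) has_real_derivative uxx t x) (at x)"
          unfolding ux_def uxx_def by (intro DERIV_cmult w'(3) t)
        show "ut t x = uxx t x + log_nonlinearity lam (u t x)" by (rule equation[OF t])
      qed
    qed
  qed
  then show ?thesis unfolding global_solution_def by blast
qed

theorem proposition1p2:
  fixes lam :: real and u0 :: "real \<Rightarrow> real"
  assumes "lam > 0" and "u0 \<in> BPC2" and "\<And>x. u0 x \<ge> 0"
  shows "(\<exists>u. global_solution lam u0 u) \<and>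
    (\<forall>u v. global_solution lam u0 u \<longrightarrow> global_solution lam u0 v \<longrightarrow>
       (\<forall>t\<ge>0. \<forall>x. u t x = v t x))"
proof (intro conjI allI impI)
  show "\<exists>u. global_solution lam u0 u" using assms by (rule solution_exists)
  fix u v :: "real \<Rightarrow> real \<Rightarrow> real" and t x :: real
  assume u: "global_solution lam u0 u" and v: "global_solution lam u0 v" and t: "t \<ge> 0"
  \<comment> \<open>The horizon \<open>t + 1\<close> is positive even for
    \<open>t = 0\<close>.\<close>
  have "solution_upto lam u0 (t + 1) u" "solution_upto lam u0 (t + 1) v"
    using u v t unfolding global_solution_def by auto
  then show "u t x = v t x"
    using solution_upto_le[OF assms(1), of u0 "t + 1"] t by (intro antisym) auto
qed

end
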